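(* Let $1\le s_1<s_2<\dots<s_k$ be fixed integers, $k\ge1$, let $L(z)=2k-\sum_{i=1}^k(z^{s_i}+z^{-s_i})$ and $R(z)=L(z)(L(z)+2)$. Then $$\lim_{n\to\infty}\frac{\log\tau(C_{2n}(s_1,\dots,s_k,n))}{n}=m(R),\qquad m(R)=\int_0^1\log|R(e^{2\pi i t})|\,dt,$$ where $n$ runs over integers $n>s_k$ for which $C_{2n}(s_1,\dots,s_k,n)$ is connected, i.e. $\gcd(s_1,\dots,s_k,n)=1$.
   Context: $C_{2n}(s_1,\dots,s_k,n)$ is the graph with vertices $0,1,\dots,2n-1$ in which each vertex $i$ is adjacent to the vertices $i\pm s_1,\dots,i\pm s_k$ and $i+n\pmod{2n}$ (a single edge joins $i$ and $i+n$, so every vertex has degree $2k+1$). $\tau(G)$ denotes the number of spanning trees of $G$. The quantity $m(R)$ is called the small Mahler measure of $R$. *)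

theory Defs
  imports "HOL-Analysis.Analysis" "HOL-Number_Theory.Cong"
begin

section \<open>Finite simple undirected graphs and spanning trees\<close>

text \<open>
  A graph is given by a vertex set \<open>V\<close> and a set \<open>E\<close> of two-element subsets of \<open>V\<close>.
  The notion of spanning tree in \<open>Graph_Theory\<close> is not usable here: there the two
  arcs representing an undirected edge already form a cycle.
\<close>

definition graph_connected :: "'a set \<Rightarrow> 'a set set \<Rightarrow> bool" where
  "graph_connected V E \<longleftrightarrow>
     V \<noteq> {} \<and> (\<forall>u\<in>V. \<forall>v\<in>V. (u, v) \<in> {(x, y). {x, y} \<in> E}\<^sup>*)"

definition graph_cycle :: "'a set set \<Rightarrow> 'a list \<Rightarrow> bool" where
  "graph_cycle E xs \<longleftrightarrow>
     3 \<le> length xs \<and> distinct xs \<and>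
     (\<forall>i<length xs. {xs ! i, xs ! (Suc i mod length xs)} \<in> E)"

definition graph_tree :: "'a set \<Rightarrow> 'a set set \<Rightarrow> bool" where
  "graph_tree V E \<longleftrightarrow> graph_connected V E \<and> (\<nexists>xs. graph_cycle E xs)"

text \<open>Spanning trees of \<open>(V, E)\<close> are identified with their edge sets.\<close>

definition spanning_trees :: "'a set \<Rightarrow> 'a set set \<Rightarrow> 'a set set set" where
  "spanning_trees V E = {T. T \<subseteq> E \<and> graph_tree V T}"

definition num_spanning_trees :: "'a set \<Rightarrow> 'a set set \<Rightarrow> nat" where
  "num_spanning_trees V E = card (spanning_trees V E)"


section \<open>Circulant graphs\<close>

text \<open>
  The vertex set is \<open>{..<m}\<close>. Since edges form a set, the jump \<open>n\<close> in a graph on \<open>2 * n\<close>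
  vertices gives the single edge between \<open>i\<close> and \<open>i + n\<close>.
\<close>

definition circulant_edges :: "nat \<Rightarrow> nat set \<Rightarrow> nat set set" where
  "circulant_edges m D =
     {{i, j} | i j. i < m \<and> j < m \<and> i \<noteq> j \<and>
        (\<exists>d\<in>D. [int j = int i + int d] (mod int m) \<or>
                [int j = int i - int d] (mod int m))}"

text \<open>
  Edges of \<open>C\<^bsub>2n\<^esub>(s\<^sub>1, \<dots>, s\<^sub>k, n)\<close>, with \<open>s\<^sub>i\<close> given as \<open>s i\<close> for \<open>i \<in> {1..k}\<close>.
\<close>

definition even_circulant_edges :: "(nat \<Rightarrow> nat) \<Rightarrow> nat \<Rightarrow> nat \<Rightarrow> nat set set" where
  "even_circulant_edges s k n = circulant_edges (2 * n) (insert n (s ` {1..k}))"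


section \<open>The Laurent polynomials and the small Mahler measure\<close>

definition L_poly :: "(nat \<Rightarrow> nat) \<Rightarrow> nat \<Rightarrow> complex \<Rightarrow> complex" where
  "L_poly s k z =
     2 * of_nat k - (\<Sum>i=1..k. z powi int (s i) + z powi (- int (s i)))"

definition R_poly :: "(nat \<Rightarrow> nat) \<Rightarrow> nat \<Rightarrow> complex \<Rightarrow> complex" where
  "R_poly s k z = L_poly s k z * (L_poly s k z + 2)"

text \<open>
  At the zeros of \<open>R\<close> on the unit circle the integrand takes the value \<open>ln 0 = 0\<close>; for a
  nonzero Laurent polynomial there are finitely many of them.
\<close>

definition small_mahler_integrand :: "(complex \<Rightarrow> complex) \<Rightarrow> real \<Rightarrow> real" where
  "small_mahler_integrand R t = ln (norm (R (exp (2 * of_real pi * \<i> * of_real t))))"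

definition small_mahler :: "(complex \<Rightarrow> complex) \<Rightarrow> real" where
  "small_mahler R = (LINT t:{0..1}|lborel. small_mahler_integrand R t)"

end

theory Submission
  imports Defs "Jordan_Normal_Form.Determinant" "HOL-Real_Asymp.Real_Asymp"
begin

text \<open>
  The number \<open>\<tau>\<close> of spanning trees of a graph on \<open>m\<close> vertices is \<open>1/m\<close> times the product of the
  Laplacian eigenvalues, with one eigenvalue \<open>0\<close> left out. For a circulant graph the eigenvectors are the characters of
  \<open>\<int>/m\<close>, so for \<open>C\<^bsub>2n\<^esub>(s\<^sub>1, \<dots>, s\<^sub>k, n)\<close> the eigenvalue at the root of unity \<open>w\<close> with
  \<open>w\<^sup>2\<^sup>n = 1\<close> is \<open>L(w) + 1 - w\<^sup>n\<close>: it is \<open>L(w)\<close> if \<open>w\<^sup>n = 1\<close> and \<open>L(w) + 2\<close> if \<open>w\<^sup>n = -1\<close>.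
  Thus \<open>ln (2n\<tau>)\<close> is a sum of \<open>ln L\<close> over the \<open>n\<close>-th roots of unity other than \<open>1\<close> and of
  \<open>ln (L + 2)\<close> over the points half-way between them
  (\<open>spanning_trees_even_circulant\<close>), and after division by \<open>n\<close> both are Riemann sums for the two
  halves of \<open>ln \<bar>R\<bar> = ln L + ln (L + 2)\<close>.

  The second half is a Riemann sum of a continuous function, since \<open>L \<ge> 0\<close> on the unit circle. The
  first has singularities where \<open>L\<close> vanishes. On the circle \<open>L(z) = \<Sum>\<^sub>i \<bar>1 - z\<^bsup>s\<^sub>i\<^esup>\<bar>\<^sup>2\<close>,
  so with \<open>g = gcd(s\<^sub>1, \<dots>, s\<^sub>k)\<close> the singular part splits off exactly:
  \<open>L(z) = \<bar>1 - z\<^sup>g\<bar>\<^sup>2 h(z\<^sup>g)\<close> with \<open>h\<close> continuous and positive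
  (\<open>L_circle_factor\<close>, \<open>L_cofactor_pos\<close>). The factor \<open>\<bar>1 - z\<^sup>g\<bar>\<close> is under full control on both sides.
  Its logarithm has integral \<open>0\<close>, by the duplication formula \<open>1 - w\<^sup>2 = (1 - w)(1 + w)\<close>
  (\<open>circle_log_has_integral\<close>). Its product over the nontrivial \<open>n\<close>-th roots of unity is \<open>n\<close> when
  \<open>g\<close> and \<open>n\<close> are coprime, since \<open>z \<mapsto> z\<^sup>g\<close> then permutes these roots
  (\<open>prod_one_minus_dilated_roots\<close>), and \<open>(ln n)/n\<close> tends to \<open>0\<close>. The coprimality of \<open>g\<close> and \<open>n\<close> is
  exactly the connectedness of the graph.

  The eigenvalue formula for \<open>\<tau>\<close> is obtained without minors. A row of \<open>x I\<close> plus the Laplacian is a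
  sum of simple vectors, one for each choice of a neighbour or of the vertex itself. Expanding the
  determinant in all rows gives a sum over maps \<open>f\<close> that send each vertex to a neighbour or to itself,
  and the term of \<open>f\<close> is \<open>x\<close> to the number of fixed points if every orbit of \<open>f\<close> ends in a fixed point,
  and \<open>0\<close> otherwise (\<open>det_shifted_laplacian\<close>). The coefficient of \<open>x\<close> therefore counts the maps whose
  orbits all end in a single fixed point, which are the spanning trees with a chosen root
  (\<open>card_parent_maps\<close>).
\<close>


section \<open>Spanning trees as parent maps\<close>

lemma sym_reachability:
  "sym ({(x, y). {x, y} \<in> F}\<^sup>*)"
  by (intro sym_rtrancl) (auto simp: sym_def insert_commute)

definition simple_graph :: "'a set \<Rightarrow> 'a set set \<Rightarrow> bool" where
  "simple_graph V E \<longleftrightarrow> (\<forall>e\<in>E. \<exists>u v. e = {u, v} \<and> u \<noteq> v \<and> u \<in> V \<and> v \<in> V)"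

text \<open>
  A spanning tree with root \<open>r\<close> is encoded by the map that sends each vertex to its parent. The root
  is its own parent, so that the map is total on \<open>V\<close>.
\<close>
definition parent_maps :: "'a set \<Rightarrow> 'a set set \<Rightarrow> 'a \<Rightarrow> ('a \<Rightarrow> 'a) set" where
  "parent_maps V E r = {f \<in> V \<rightarrow>\<^sub>E V. f r = r \<and> (\<forall>v\<in>V - {r}. {v, f v} \<in> E) \<and>
     (\<forall>v\<in>V. \<exists>n. (f ^^ n) v = r)}"

definition parent_edges :: "'a set \<Rightarrow> 'a \<Rightarrow> ('a \<Rightarrow> 'a) \<Rightarrow> 'a set set" where
  "parent_edges V r f = (\<lambda>v. {v, f v}) ` (V - {r})"

lemma funpow_invariant:
  assumes "x \<in> C" "\<And>y. y \<in> C \<Longrightarrow> f y \<in> C"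
  shows "(f ^^ n) x \<in> C"
  by (induction n) (use assms in auto)

lemma parent_edges_connected:
  assumes "f \<in> parent_maps V E r" "r \<in> V"
  shows "graph_connected V (parent_edges V r f)"
proof -
  let ?R = "{(x, y). {x, y} \<in> parent_edges V r f}"
  have fV: "f v \<in> V" if "v \<in> V" for v
    using assms that by (auto simp: parent_maps_def)
  have down: "(v, (f ^^ n) v) \<in> ?R\<^sup>*" if "v \<in> V" for v n
  proof (induction n)
    case (Suc n)
    have inV: "(f ^^ n) v \<in> V" using funpow_invariant[of v V f n] that fV by blast
    show ?case
    proof (cases "(f ^^ n) v = r")
      case True
      then show ?thesis using Suc assms by (simp add: parent_maps_def)
    next
      case False
      then have "((f ^^ n) v, f ((f ^^ n) v)) \<in> ?R" using inV by (auto simp: parent_edges_def)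
      then show ?thesis using Suc by (simp add: rtrancl.rtrancl_into_rtrancl)
    qed
  qed simp
  have to_r: "(v, r) \<in> ?R\<^sup>*" if v: "v \<in> V" for v
  proof -
    obtain n where n: "(f ^^ n) v = r" using assms v by (auto simp: parent_maps_def)
    show ?thesis using down[OF v, of n] n by simp
  qed
  have "(r, v) \<in> ?R\<^sup>*" if "v \<in> V" for v
    using sym_reachability to_r[OF that] by (rule symD)
  then have "(u, v) \<in> ?R\<^sup>*" if "u \<in> V" "v \<in> V" for u v
    using to_r[OF that(1)] that(2) by (meson rtrancl_trans)
  then show ?thesis using assms(2) unfolding graph_connected_def by blast
qed

text \<open>
  Measure vertices by their distance to the root along \<open>f\<close>. On a cycle, both neighbours of a vertex of
  maximal distance would have to be its parent.
\<close>
lemma parent_edges_acyclic: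
  assumes "f \<in> parent_maps V E r"
  shows "\<not> graph_cycle (parent_edges V r f) xs"
proof
  assume cyc: "graph_cycle (parent_edges V r f) xs"
  define d where "d v = (LEAST n. (f ^^ n) v = r)" for v
  have d_Suc: "d v = Suc (d (f v))" if v: "v \<in> V" "v \<noteq> r" for v
  proof -
    obtain n where n: "(f ^^ n) v = r" using assms v by (auto simp: parent_maps_def)
    have "(LEAST n. (f ^^ n) v = r) = Suc (LEAST n. (f ^^ Suc n) v = r)"
      using n v(2) by (intro Least_Suc[of _ n]) auto
    then show ?thesis by (simp add: d_def funpow_swap1)
  qed
  have up: "w = f u" if uw: "{u, w} \<in> parent_edges V r f" and le: "d w \<le> d u" for u w
  proof -
    obtain v where v: "v \<in> V" "v \<noteq> r" "{u, w} = {v, f v}" using uw by (auto simp: parent_edges_def)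
    then consider "u = v" "w = f v" | "u = f v" "w = v" by (auto simp: doubleton_eq_iff)
    then show ?thesis using d_Suc[OF v(1,2)] le by cases auto
  qed
  let ?n = "length xs"
  have n3: "3 \<le> ?n" and dist: "distinct xs"
    and edge: "\<And>i. i < ?n \<Longrightarrow> {xs ! i, xs ! (Suc i mod ?n)} \<in> parent_edges V r f"
    using cyc by (auto simp: graph_cycle_def)
  have "0 \<in> {..<?n}" unfolding lessThan_iff using n3 by linarith
  then have "{..<?n} \<noteq> {}" by blast
  then have "Max ((\<lambda>j. d (xs ! j)) ` {..<?n}) \<in> (\<lambda>j. d (xs ! j)) ` {..<?n}"
    by (intro Max_in) auto
  then obtain i where i: "i < ?n" "Max ((\<lambda>j. d (xs ! j)) ` {..<?n}) = d (xs ! i)" by auto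
  have imax: "d (xs ! j) \<le> d (xs ! i)" if "j < ?n" for j
    using Max_ge[of "(\<lambda>j. d (xs ! j)) ` {..<?n}" "d (xs ! j)"] that i(2) by auto
  \<comment> \<open>\<open>p\<close> and \<open>q\<close> are the cyclic predecessor and successor of the position \<open>i\<close>\<close>
  define p where "p = (if i = 0 then ?n - 1 else i - 1)"
  define q where "q = Suc i mod ?n"
  have p: "p < ?n" "Suc p mod ?n = i" using i n3 by (auto simp: p_def)
  have q: "q < ?n" unfolding q_def using n3 by (intro mod_less_divisor) linarith
  have "xs ! q = f (xs ! i)"
    using edge[OF i(1)] imax[OF q] by (intro up) (auto simp: q_def)
  moreover have "xs ! p = f (xs ! i)"
    using edge[OF p(1)] p(2) imax[OF p(1)] by (intro up) (auto simp: insert_commute)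
  ultimately have "p = q" using nth_eq_iff_index_eq[OF dist p(1) q] by simp
  then show False using i(1) n3 by (auto simp: p_def q_def mod_Suc split: if_splits)
qed

lemma rtrancl_imp_simple_path:
  assumes "(u, w) \<in> {(x, y). {x, y} \<in> F}\<^sup>*"
  shows "\<exists>xs. xs \<noteq> [] \<and> distinct xs \<and> hd xs = u \<and> last xs = w \<and> successively (\<lambda>x y. {x, y} \<in> F) xs"
  using assms
proof (induction rule: converse_rtrancl_induct)
  case base
  show ?case by (rule exI[of _ "[w]"]) simp
next
  case (step u v)
  then obtain xs where xs: "xs \<noteq> []" "distinct xs" "hd xs = v" "last xs = w"
    "successively (\<lambda>x y. {x, y} \<in> F) xs" by blast
  show ?case
  proof (cases "u \<in> set xs")
    case True
    then obtain ys zs where "xs = ys @ u # zs" by (auto dest: split_list)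
    then show ?thesis using xs by (intro exI[of _ "u # zs"]) (auto simp: successively_append_iff)
  next
    case False
    then show ?thesis using xs step
      by (intro exI[of _ "u # xs"]) (auto simp: successively_Cons)
  qed
qed

text \<open>
  An edge of \<open>T\<close> outside \<open>F\<close> would close a simple path of \<open>F\<close> between its ends to a cycle of \<open>T\<close>.
\<close>
lemma connected_subgraph_of_acyclic:
  assumes "graph_connected V F" "F \<subseteq> T" "\<nexists>xs. graph_cycle T xs"
    and "simple_graph V T"
  shows "F = T"
proof (rule ccontr)
  assume "F \<noteq> T"
  then obtain e where e: "e \<in> T" "e \<notin> F" using assms(2) by blast
  then obtain u w where uw: "e = {u, w}" "u \<noteq> w" "u \<in> V" "w \<in> V" using assms(4) unfolding simple_graph_def by blast
  have path: "(u, w) \<in> {(x, y). {x, y} \<in> F}\<^sup>*" using assms(1) uw by (auto simp: graph_connected_def)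
  obtain xs where xs: "xs \<noteq> []" "distinct xs" "hd xs = u" "last xs = w"
    "successively (\<lambda>x y. {x, y} \<in> F) xs" using rtrancl_imp_simple_path[OF path] by (elim exE conjE)
  let ?n = "length xs"
  have consec: "{xs ! i, xs ! Suc i} \<in> F" if "Suc i < ?n" for i
    using xs(5) that by (auto simp: successively_conv_nth)
  have ends: "xs ! 0 = u" "xs ! (?n - 1) = w" using xs(1,3,4) by (auto simp: hd_conv_nth last_conv_nth)
  have "?n \<noteq> 1" using ends uw(2) by auto
  moreover have "?n \<noteq> 2" using ends consec[of 0] uw(1) e(2) by auto
  moreover have "?n \<noteq> 0" using xs(1) by simp
  ultimately have n3: "3 \<le> ?n" by linarith
  have "graph_cycle T xs"
    unfolding graph_cycle_def
  proof (intro conjI allI impI)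
    fix i assume i: "i < ?n"
    show "{xs ! i, xs ! (Suc i mod ?n)} \<in> T"
    proof (cases "Suc i < ?n")
      case True
      then show ?thesis using consec[of i] assms(2) by auto
    next
      case False
      then have "i = ?n - 1" "Suc i = ?n" using i by auto
      then show ?thesis using ends e(1) uw(1) by (simp add: insert_commute)
    qed
  qed (use n3 xs(2) in auto)
  then show False using assms(3) by blast
qed

text \<open>
  Let \<open>f\<close> and \<open>g\<close> have the same edges but differ at \<open>v\<close>. The edge from \<open>v\<close> to \<open>g v\<close> can then only be an
  edge of \<open>f\<close> as \<open>f (g v) = v\<close>, so the two maps run through it in opposite directions, and they differ
  again at \<open>g v\<close>. Hence the orbit of \<open>v\<close> under \<open>g\<close> never reaches the root.
\<close>
lemma inj_on_parent_edges:
  assumes "r \<in> V"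
  shows "inj_on (parent_edges V r) (parent_maps V E r)"
proof (rule inj_onI)
  fix f g assume f: "f \<in> parent_maps V E r" and g: "g \<in> parent_maps V E r"
    and eq: "parent_edges V r f = parent_edges V r g"
  have reach: "r \<in> C" if v: "v \<in> V" "v \<in> C" "\<And>y. y \<in> C \<Longrightarrow> g y \<in> C" for v C
  proof -
    obtain n where n: "(g ^^ n) v = r" using g v(1) by (auto simp: parent_maps_def)
    show ?thesis using funpow_invariant[of v C g n] v n by auto
  qed
  have gV: "g v \<in> V" if "v \<in> V" for v using g that by (auto simp: parent_maps_def)
  define C where "C = {v \<in> V. v \<noteq> r \<and> f v \<noteq> g v}"
  have step: "g v \<in> C" if v: "v \<in> C" for v
  proof -
    have "{v, g v} \<in> parent_edges V r f" using v unfolding eq by (auto simp: C_def parent_edges_def)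
    then obtain x where x: "x \<in> V" "x \<noteq> r" "{v, g v} = {x, f x}" by (auto simp: parent_edges_def)
    then have gv: "x = g v" "f (g v) = v" using v by (auto simp: C_def doubleton_eq_iff)
    \<comment> \<open>otherwise the orbit of \<open>v\<close> under \<open>g\<close> would be \<open>{v, g v}\<close>, without \<open>r\<close>\<close>
    have "g (g v) \<noteq> v"
    proof
      assume "g (g v) = v"
      then have "r \<in> {v, g v}" using v by (intro reach[of v]) (auto simp: C_def)
      then show False using v x gv by (auto simp: C_def)
    qed
    then show ?thesis using gv x by (auto simp: C_def)
  qed
  have agree: "f v = g v" if "v \<in> V" for v
  proof (rule ccontr)
    assume "f v \<noteq> g v"
    then have "v \<in> C" using that f g by (auto simp: C_def parent_maps_def)
    then have "r \<in> C" using reach step that by blast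
    then show False by (simp add: C_def)
  qed
  show "f = g"
    by (rule PiE_ext[of f V "\<lambda>_. V" g]) (use f g agree in \<open>auto simp: parent_maps_def\<close>)
qed

text \<open>
  The parent of a vertex is a neighbour closer to the root. The edges chosen in this way already connect
  \<open>V\<close>, so by acyclicity they are all of \<open>T\<close>.
\<close>
lemma spanning_tree_has_parent_map:
  assumes "r \<in> V" and T: "T \<in> spanning_trees V E"
    and E: "simple_graph V E"
  shows "\<exists>f\<in>parent_maps V E r. parent_edges V r f = T"
proof -
  have TE: "T \<subseteq> E" and conn: "graph_connected V T" and acyc: "\<nexists>xs. graph_cycle T xs"
    using T by (auto simp: spanning_trees_def graph_tree_def)
  define R where "R = {(x, y). {x, y} \<in> T}"
  define d where "d v = (LEAST n. (v, r) \<in> R ^^ n)" for v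
  have closer: "\<exists>w. {v, w} \<in> T \<and> d w < d v" if v: "v \<in> V" "v \<noteq> r" for v
  proof -
    have "(v, r) \<in> R\<^sup>*" using conn v assms(1) by (auto simp: graph_connected_def R_def)
    then have "\<exists>n. (v, r) \<in> R ^^ n" by (simp add: rtrancl_power)
    then have dv: "(v, r) \<in> R ^^ d v" unfolding d_def by (rule LeastI_ex)
    then obtain m where m: "d v = Suc m" using v(2) by (cases "d v") auto
    obtain w where "(v, w) \<in> R" "(w, r) \<in> R ^^ m" using relpow_Suc_D2 dv unfolding m by metis
    moreover from this(2) have "d w \<le> m" unfolding d_def by (rule Least_le)
    ultimately show ?thesis using m by (auto simp: R_def)
  qed
  define p where "p v = (SOME w. {v, w} \<in> T \<and> d w < d v)" for v
  have p: "{v, p v} \<in> T \<and> d (p v) < d v" if "v \<in> V - {r}" for v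
    unfolding p_def by (rule someI_ex) (use closer that in auto)
  define f where "f = restrict (p(r := r)) V"
  have f_edge: "{v, f v} \<in> T" "d (f v) < d v" "f v \<in> V" if "v \<in> V" "v \<noteq> r" for v
  proof -
    show 1: "{v, f v} \<in> T" "d (f v) < d v" using p[of v] that by (auto simp: f_def)
    show "f v \<in> V" using E 1 TE by (fastforce simp: simple_graph_def doubleton_eq_iff)
  qed
  have fr: "f r = r" using assms(1) by (simp add: f_def)
  have reach: "\<exists>n. (f ^^ n) v = r" if "v \<in> V" for v
    using that
  proof (induction "d v" arbitrary: v rule: less_induct)
    case less
    show ?case
    proof (cases "v = r")
      case True
      then show ?thesis by (intro exI[of _ 0]) simp
    next
      case False
      then obtain n where "(f ^^ n) (f v) = r" using less f_edge by blast
      then show ?thesis by (intro exI[of _ "Suc n"]) (simp add: funpow_swap1)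
    qed
  qed
  have pm: "f \<in> parent_maps V E r"
    unfolding parent_maps_def
  proof (intro CollectI conjI ballI)
    show "f \<in> V \<rightarrow>\<^sub>E V"
    proof (rule PiE_I)
      fix v assume "v \<in> V" then show "f v \<in> V" using f_edge(3) fr by metis
    qed (simp add: f_def)
  qed (use fr f_edge TE reach in auto)
  have "parent_edges V r f \<subseteq> T" using f_edge by (auto simp: parent_edges_def)
  then have "parent_edges V r f = T"
    by (rule connected_subgraph_of_acyclic[OF parent_edges_connected[OF pm assms(1)]])
       (use acyc E TE in \<open>auto simp: simple_graph_def\<close>)
  then show ?thesis using pm by blast
qed

lemma card_parent_maps:
  assumes "r \<in> V" "simple_graph V E"
  shows "card (parent_maps V E r) = num_spanning_trees V E"
proof -
  have "parent_edges V r ` parent_maps V E r = spanning_trees V E"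
  proof
    show "spanning_trees V E \<subseteq> parent_edges V r ` parent_maps V E r"
      using spanning_tree_has_parent_map[OF assms(1) _ assms(2)] by blast
    show "parent_edges V r ` parent_maps V E r \<subseteq> spanning_trees V E"
    proof (rule image_subsetI)
      fix f assume f: "f \<in> parent_maps V E r"
      then have "parent_edges V r f \<subseteq> E" by (auto simp: parent_maps_def parent_edges_def)
      then show "parent_edges V r f \<in> spanning_trees V E"
        using parent_edges_connected[OF f assms(1)] parent_edges_acyclic[OF f]
        unfolding spanning_trees_def graph_tree_def by blast
    qed
  qed
  then show ?thesis unfolding num_spanning_trees_def
    using card_image[OF inj_on_parent_edges[OF assms(1)]] by metis
qed

section \<open>Determinant of the shifted Laplacian\<close>

text \<open>
  With \<open>e\<^sub>i\<close> the unit vectors, this is the vector \<open>e\<^sub>i - e\<^sub>u\<close>, one summand of row \<open>i\<close> of a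
  Laplacian, for \<open>u \<noteq> i\<close>; the choice \<open>u = i\<close> encodes the summand \<open>x e\<^sub>i\<close>.
\<close>
definition choice_row :: "'a::comm_ring_1 \<Rightarrow> nat \<Rightarrow> nat \<Rightarrow> nat \<Rightarrow> 'a" where
  "choice_row x i u j = (if u = i then (if j = i then x else 0)
     else (if j = i then 1 else 0) - (if j = u then 1 else 0))"

definition orbits_end_fixed :: "nat \<Rightarrow> (nat \<Rightarrow> nat) \<Rightarrow> bool" where
  "orbits_end_fixed m f \<longleftrightarrow> (\<forall>v<m. \<exists>n. f ((f ^^ n) v) = (f ^^ n) v)"

lemma det_mat_fun:
  "Determinant.det (Matrix.mat m m (\<lambda>(i, j). c i j)) =
     (\<Sum>p | p permutes {0..<m}. signof p * (\<Prod>i = 0..<m. c i (p i)))"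
  unfolding det_def'[of _ m, OF mat_carrier]
proof (intro sum.cong refl arg_cong2[of _ _ _ _ "(*)"] prod.cong)
  fix p i assume "p \<in> {p. p permutes {0..<m}}" "i \<in> {0..<m}"
  then show "Matrix.mat m m (\<lambda>(i, j). c i j) $$ (i, p i) = c i (p i)"
    using permutes_in_image[of p "{0..<m}" i] by auto
qed

text \<open>
  Only the identity contributes to the Leibniz formula. A permutation \<open>p\<close> with a nonzero term has
  \<open>p i = i\<close> or \<open>p i = f i\<close> everywhere; if it moves \<open>i\<close>, then \<open>p i = f i\<close>, so by injectivity it moves
  \<open>f i\<close> as well, and it would move the whole orbit of \<open>i\<close>, which contains a fixed point of \<open>f\<close>.
\<close>
lemma det_choice_orbits_end_fixed:
  fixes x :: "'a::comm_ring_1"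
  assumes fV: "\<And>v. v < m \<Longrightarrow> f v < m" and "orbits_end_fixed m f"
  shows "Determinant.det (Matrix.mat m m (\<lambda>(i, j). choice_row x i (f i) j)) = x ^ card {v. v < m \<and> f v = v}"
proof -
  let ?c = "\<lambda>i j. choice_row x i (f i) j"
  have zero: "(\<Prod>i = 0..<m. ?c i (p i)) = 0" if p: "p permutes {0..<m}" "p \<noteq> id" for p
  proof (rule ccontr)
    assume nz: "(\<Prod>i = 0..<m. ?c i (p i)) \<noteq> 0"
    have opts: "p i = i \<or> (f i \<noteq> i \<and> p i = f i)" if i: "i < m" for i
    proof (rule ccontr)
      assume "\<not> ?thesis"
      then have "?c i (p i) = 0" by (auto simp: choice_row_def)
      then have "(\<Prod>i = 0..<m. ?c i (p i)) = 0" using i by (intro prod_zero) auto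
      then show False using nz by simp
    qed
    obtain i where i: "p i \<noteq> i" using p(2) by (auto simp: fun_eq_iff)
    then have im: "i < m" using p(1) by (auto simp: permutes_def)
    have "p v \<noteq> v \<and> v < m" if "v = (f ^^ n) i" for n v
      using that
    proof (induction n arbitrary: v)
      case 0
      then show ?case using i im by simp
    next
      case (Suc n)
      let ?w = "(f ^^ n) i"
      have w: "p ?w \<noteq> ?w" "?w < m" using Suc.IH by auto
      then have "p ?w = f ?w" using opts by blast
      moreover have "p (f ?w) \<noteq> f ?w"
        using w calculation permutes_inj[OF p(1)] by (metis injD)
      ultimately show ?case using fV w Suc.prems by auto
    qed
    then have moved: "p ((f ^^ n) i) \<noteq> (f ^^ n) i" "(f ^^ n) i < m" for n by auto
    obtain n where "f ((f ^^ n) i) = (f ^^ n) i" using assms(2) im by (auto simp: orbits_end_fixed_def)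
    then show False using moved[of n] opts[of "(f ^^ n) i"] by auto
  qed
  have "Determinant.det (Matrix.mat m m (\<lambda>(i, j). ?c i j)) =
      (\<Sum>p | p permutes {0..<m}. signof p * (\<Prod>i = 0..<m. ?c i (p i)))"
    by (rule det_mat_fun)
  also have "\<dots> = (\<Sum>p\<in>{id}. signof p * (\<Prod>i = 0..<m. ?c i (p i)))"
    by (intro sum.mono_neutral_right) (auto simp: finite_permutations permutes_id zero)
  also have "\<dots> = (\<Prod>i = 0..<m. if f i = i then x else 1)"
    by (auto intro!: prod.cong simp: choice_row_def)
  also have "\<dots> = x ^ card {v. v < m \<and> f v = v}"
    by (simp add: prod.If_cases prod_constant Int_def)
  finally show ?thesis .
qed

text \<open>
  The indicator vector of the set of vertices whose orbit meets no fixed point lies in the kernel.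
\<close>
lemma det_choice_not_orbits_end_fixed:
  fixes x :: "'a::idom"
  assumes fV: "\<And>v. v < m \<Longrightarrow> f v < m" and "\<not> orbits_end_fixed m f"
  shows "Determinant.det (Matrix.mat m m (\<lambda>(i, j). choice_row x i (f i) j)) = 0"
proof -
  define C where "C = {v. v < m \<and> (\<forall>n. f ((f ^^ n) v) \<noteq> (f ^^ n) v)}"
  have C_f: "f v \<in> C \<longleftrightarrow> v \<in> C" if v: "v < m" "f v \<noteq> v" for v
  proof -
    have "(\<forall>n. f ((f ^^ n) v) \<noteq> (f ^^ n) v) \<longleftrightarrow> (\<forall>n. f ((f ^^ Suc n) v) \<noteq> (f ^^ Suc n) v)"
      using v(2) by (metis funpow_0 not0_implies_Suc)
    also have "\<dots> \<longleftrightarrow> (\<forall>n. f ((f ^^ n) (f v)) \<noteq> (f ^^ n) (f v))"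
      by (simp add: funpow_swap1)
    finally show ?thesis using v fV by (auto simp: C_def)
  qed
  have C_fix: "v \<notin> C" if "f v = v" for v using that by (auto simp: C_def intro: exI[of _ 0])
  obtain c where c: "c \<in> C" using assms(2) by (auto simp: orbits_end_fixed_def C_def)
  let ?A = "Matrix.mat m m (\<lambda>(i, j). choice_row x i (f i) j)"
  define v :: "'a Matrix.vec" where "v = Matrix.vec m (\<lambda>i. if i \<in> C then 1 else 0)"
  have "?A *\<^sub>v v = 0\<^sub>v m"
  proof (rule eq_vecI)
    fix i assume "i < dim_vec (0\<^sub>v m :: 'a Matrix.vec)"
    then have i: "i < m" by simp
    let ?u = "\<lambda>j. if j \<in> C then 1 else (0::'a)"
    have "vec_index (?A *\<^sub>v v) i = (\<Sum>j = 0..<m. choice_row x i (f i) j * ?u j)"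
      using i by (auto simp: v_def scalar_prod_def intro!: sum.cong)
    also have "\<dots> = (if f i = i then x * ?u i else ?u i - ?u (f i))"
    proof (cases "f i = i")
      case True
      have "(\<Sum>j = 0..<m. choice_row x i (f i) j * ?u j) = (\<Sum>j = 0..<m. if j = i then x * ?u i else 0)"
        using True by (intro sum.cong) (auto simp: choice_row_def)
      then show ?thesis using True i by simp
    next
      case False
      have "(\<Sum>j = 0..<m. choice_row x i (f i) j * ?u j) =
          (\<Sum>j = 0..<m. (if j = i then ?u i else 0) - (if j = f i then ?u (f i) else 0))"
        using False by (intro sum.cong) (auto simp: choice_row_def)
      then show ?thesis using False i fV[OF i] by (simp add: sum_subtractf)
    qed
    also have "\<dots> = 0" using C_fix[of i] C_f[of i] i by auto
    finally show "vec_index (?A *\<^sub>v v) i = vec_index (0\<^sub>v m) i" using i by simp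
  qed simp
  moreover have "v \<in> carrier_vec m" by (simp add: v_def)
  moreover have "v \<noteq> 0\<^sub>v m"
  proof
    assume "v = 0\<^sub>v m"
    then have "vec_index v c = 0" using c by (simp add: C_def)
    then show False using c by (simp add: v_def C_def)
  qed
  ultimately show ?thesis by (subst det_0_iff_vec_prod_zero[of _ m]) auto
qed

lemma det_sum_rows:
  fixes a :: "nat \<Rightarrow> 'b \<Rightarrow> nat \<Rightarrow> 'a::comm_ring_1"
  assumes "\<And>i. i < m \<Longrightarrow> finite (B i)"
  shows "Determinant.det (Matrix.mat m m (\<lambda>(i, j). \<Sum>u\<in>B i. a i u j)) =
    (\<Sum>f \<in> Pi\<^sub>E {0..<m} B. Determinant.det (Matrix.mat m m (\<lambda>(i, j). a i (f i) j)))"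
proof -
  let ?P = "{p. p permutes {0..<m}}"
  have D: "Determinant.det (Matrix.mat m m (\<lambda>(i, j). c i j)) =
      (\<Sum>p\<in>?P. signof p * (\<Prod>i = 0..<m. c i (p i)))" for c :: "nat \<Rightarrow> nat \<Rightarrow> 'a"
    by (rule det_mat_fun)
  have "Determinant.det (Matrix.mat m m (\<lambda>(i, j). \<Sum>u\<in>B i. a i u j)) =
     (\<Sum>p\<in>?P. \<Sum>f \<in> Pi\<^sub>E {0..<m} B. signof p * (\<Prod>i = 0..<m. a i (f i) (p i)))"
    unfolding D using assms by (intro sum.cong refl) (subst prod_sum_PiE, auto simp: sum_distrib_left)
  also have "\<dots> = (\<Sum>f \<in> Pi\<^sub>E {0..<m} B. \<Sum>p\<in>?P. signof p * (\<Prod>i = 0..<m. a i (f i) (p i)))"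
    by (rule sum.swap)
  finally show ?thesis unfolding D .
qed

text \<open>
  A weighted form of the matrix forest theorem: if \<open>N\<close> gives the neighbourhoods of a graph, the maps on
  the right are the spanning forests in which each tree has a chosen root, with weight \<open>x\<close> for each
  root.
\<close>
lemma det_shifted_laplacian:
  fixes x :: "'a::idom"
  assumes N: "\<And>i. i < m \<Longrightarrow> N i \<subseteq> {..<m}"
  shows "Determinant.det (Matrix.mat m m (\<lambda>(i, j). \<Sum>u\<in>insert i (N i). choice_row x i u j)) =
    (\<Sum>f \<in> {f \<in> Pi\<^sub>E {0..<m} (\<lambda>i. insert i (N i)). orbits_end_fixed m f}. x ^ card {v. v < m \<and> f v = v})"
proof -
  have fin: "finite (insert i (N i))" if "i < m" for i
    using N[OF that] finite_subset by blast
  have inm: "f v < m" if "f \<in> Pi\<^sub>E {0..<m} (\<lambda>i. insert i (N i))" "v < m" for f v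
    using PiE_mem[OF that(1), of v] that(2) N[of v] by auto
  have "Determinant.det (Matrix.mat m m (\<lambda>(i, j). \<Sum>u\<in>insert i (N i). choice_row x i u j)) =
     (\<Sum>f \<in> Pi\<^sub>E {0..<m} (\<lambda>i. insert i (N i)).
        if orbits_end_fixed m f then x ^ card {v. v < m \<and> f v = v} else 0)"
    by (subst det_sum_rows[OF fin])
       (auto intro!: sum.cong simp: det_choice_orbits_end_fixed det_choice_not_orbits_end_fixed inm)
  also have "\<dots> = (\<Sum>f \<in> {f \<in> Pi\<^sub>E {0..<m} (\<lambda>i. insert i (N i)). orbits_end_fixed m f}. x ^ card {v. v < m \<and> f v = v})"
    using fin by (intro sum.inter_filter[symmetric] finite_PiE) auto
  finally show ?thesis .
qed

section \<open>Spanning trees and Laplacian eigenvalues\<close>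

lemma single_fixpoint_maps:
  fixes E :: "nat set set"
  assumes E: "simple_graph {..<m} E"
  shows "{f \<in> Pi\<^sub>E {0..<m} (\<lambda>i. insert i {u. u < m \<and> {i, u} \<in> E}).
      orbits_end_fixed m f \<and> card {v. v < m \<and> f v = v} = 1} = (\<Union>r<m. parent_maps {..<m} E r)" (is "?A = ?B")
proof (intro equalityI subsetI)
  fix f assume "f \<in> ?A"
  then have f: "f \<in> Pi\<^sub>E {0..<m} (\<lambda>i. insert i {u. u < m \<and> {i, u} \<in> E})"
    and s: "orbits_end_fixed m f" and c: "card {v. v < m \<and> f v = v} = 1" by auto
  from c obtain r where r: "{v. v < m \<and> f v = v} = {r}" by (auto simp: card_1_singleton_iff)
  have fv: "f v = v \<or> (f v < m \<and> {v, f v} \<in> E)" if "v < m" for v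
    using PiE_mem[OF f, of v] that by auto
  have fV: "f v < m" if "v < m" for v using fv[OF that] that by auto
  have "f \<in> parent_maps {..<m} E r"
    unfolding parent_maps_def
  proof (intro CollectI conjI ballI)
    show "f \<in> {..<m} \<rightarrow>\<^sub>E {..<m}"
      using f fV by (auto simp: PiE_iff atLeast0LessThan)
    show "f r = r" using r by auto
    show "{v, f v} \<in> E" if "v \<in> {..<m} - {r}" for v using fv[of v] r that by auto
    show "\<exists>n. (f ^^ n) v = r" if v: "v \<in> {..<m}" for v
    proof -
      obtain n where n: "f ((f ^^ n) v) = (f ^^ n) v" using s v by (auto simp: orbits_end_fixed_def)
      have "(f ^^ n) v \<in> {..<m}" by (rule funpow_invariant[OF v]) (use fV in auto)
      then show ?thesis using n r by (intro exI[of _ n]) auto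
    qed
  qed
  then show "f \<in> ?B" using r by auto
next
  fix f assume "f \<in> ?B"
  then obtain r where r: "r < m" and f: "f \<in> parent_maps {..<m} E r" by auto
  have fP: "f \<in> {..<m} \<rightarrow>\<^sub>E {..<m}" and fr: "f r = r"
    and fe: "\<And>v. v < m \<Longrightarrow> v \<noteq> r \<Longrightarrow> {v, f v} \<in> E"
    and reach: "\<And>v. v < m \<Longrightarrow> \<exists>n. (f ^^ n) v = r"
    using f by (auto simp: parent_maps_def)
  have fV: "f v < m" if "v < m" for v using fP that by auto
  have "f v \<noteq> v" if "v < m" "v \<noteq> r" for v
    using E fe[OF that] by (auto simp: simple_graph_def doubleton_eq_iff)
  then have "{v. v < m \<and> f v = v} = {r}" using r fr by auto
  moreover have "orbits_end_fixed m f" unfolding orbits_end_fixed_def using reach fr by metis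
  moreover have "f \<in> Pi\<^sub>E {0..<m} (\<lambda>i. insert i {u. u < m \<and> {i, u} \<in> E})"
  proof (rule PiE_I)
    fix i assume "i \<in> {0..<m}"
    then show "f i \<in> insert i {u. u < m \<and> {i, u} \<in> E}" using fV[of i] fe[of i] fr by (cases "i = r") auto
  next
    fix i assume "i \<notin> {0..<m}"
    then show "f i = undefined" using PiE_arb[OF fP, of i] by simp
  qed
  ultimately show "f \<in> ?A" by simp
qed

lemma card_single_fixpoint_maps:
  fixes E :: "nat set set"
  assumes E: "simple_graph {..<m} E"
  shows "card {f \<in> Pi\<^sub>E {0..<m} (\<lambda>i. insert i {u. u < m \<and> {i, u} \<in> E}).
      orbits_end_fixed m f \<and> card {v. v < m \<and> f v = v} = 1} = m * num_spanning_trees {..<m} E"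
proof -
  have disj: "parent_maps {..<m} E r \<inter> parent_maps {..<m} E r' = {}"
    if r: "r < m" "r' < m" "r \<noteq> r'" for r r'
  proof (rule ccontr)
    assume "\<not> ?thesis"
    then obtain f where f: "f \<in> parent_maps {..<m} E r" "f \<in> parent_maps {..<m} E r'" by blast
    have "f r = r" using f(1) by (simp add: parent_maps_def)
    moreover have "\<forall>v\<in>{..<m} - {r'}. {v, f v} \<in> E" using f(2) by (simp add: parent_maps_def)
    then have "{r, f r} \<in> E" using r by blast
    ultimately have "{r, r} \<in> E" by simp
    then show False using E by (auto simp: simple_graph_def)
  qed
  have fin: "finite (parent_maps {..<m} E r)" for r
    by (rule finite_subset[of _ "{..<m} \<rightarrow>\<^sub>E {..<m}"]) (auto simp: parent_maps_def intro: finite_PiE)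
  have "card (\<Union>r<m. parent_maps {..<m} E r) = (\<Sum>r<m. card (parent_maps {..<m} E r))"
    using fin disj by (intro card_UN_disjoint) auto
  also have "\<dots> = (\<Sum>r<m. num_spanning_trees {..<m} E)"
    using E by (intro sum.cong refl card_parent_maps) auto
  finally have "card (\<Union>r<m. parent_maps {..<m} E r) = m * num_spanning_trees {..<m} E" by simp
  then show ?thesis unfolding single_fixpoint_maps[OF E] .
qed

text \<open>
  Both sides are the coefficient of \<open>x\<close> in the determinant: on the left by counting rooted spanning
  trees, on the right from the factorisation, in which the eigenvalue \<open>0\<close> contributes the factor \<open>x\<close>.
\<close>
theorem spanning_trees_eq_prod_eigenvalues:
  fixes E :: "nat set set" and ev :: "nat \<Rightarrow> complex"
  assumes E: "simple_graph {..<m} E"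
    and m: "m > 0" and ev0: "ev 0 = 0"
    and det: "\<And>x. Determinant.det (Matrix.mat m m
        (\<lambda>(i, j). \<Sum>u\<in>insert i {u. u < m \<and> {i, u} \<in> E}. choice_row x i u j)) = (\<Prod>l<m. x + ev l)"
  shows "of_nat (m * num_spanning_trees {..<m} E) = (\<Prod>l=1..<m. ev l)"
proof -
  let ?F = "{f \<in> Pi\<^sub>E {0..<m} (\<lambda>i. insert i {u. u < m \<and> {i, u} \<in> E}). orbits_end_fixed m f}"
  let ?fix = "\<lambda>f. card {v. v < m \<and> f v = v}"
  define p :: "complex poly" where "p = (\<Sum>f\<in>?F. monom 1 (?fix f))"
  define q where "q = (\<Prod>l=1..<m. [:ev l, 1:])"
  have finF: "finite ?F"
    by (rule finite_subset[of _ "Pi\<^sub>E {0..<m} (\<lambda>i. insert i {u. u < m \<and> {i, u} \<in> E})"])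
       (auto intro!: finite_PiE)
  have "poly p x = poly ([:0, 1:] * q) x" for x
  proof -
    have "poly p x = (\<Prod>l<m. x + ev l)"
      unfolding det[symmetric] by (subst det_shifted_laplacian) (auto simp: p_def poly_sum poly_monom)
    also have "{..<m} = insert 0 {1..<m}" using m by auto
    finally show ?thesis by (simp add: ev0 q_def poly_prod add.commute)
  qed
  then have "poly p = poly ([:0, 1:] * q)" by (rule ext)
  then have "p = [:0, 1:] * q" by (simp only: poly_eq_poly_eq_iff)
  then have "coeff p 1 = coeff q 0" by simp
  also have "\<dots> = (\<Prod>l=1..<m. ev l)" by (simp add: q_def poly_prod flip: poly_0_coeff_0)
  also have "coeff p 1 = (\<Sum>f\<in>?F. if ?fix f = 1 then 1 else 0)"
    by (simp add: p_def coeff_sum)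
  also have "\<dots> = of_nat (card {f \<in> ?F. ?fix f = 1})"
    using finF by (simp add: sum.If_cases Int_def)
  also have "{f \<in> ?F. ?fix f = 1} = {f \<in> Pi\<^sub>E {0..<m} (\<lambda>i. insert i {u. u < m \<and> {i, u} \<in> E}).
      orbits_end_fixed m f \<and> ?fix f = 1}" by blast
  finally show ?thesis using card_single_fixpoint_maps[OF E] by simp
qed

section \<open>Eigenvalues of circulant graphs\<close>

definition unit_root :: "nat \<Rightarrow> nat \<Rightarrow> complex" where
  "unit_root m l = cis (2 * pi * real l / real m)"

lemma unit_root_power_order: "m > 0 \<Longrightarrow> unit_root m l ^ m = 1"
proof -
  assume "m > 0"
  then have "real m * (2 * pi * real l / real m) = 2 * pi * real l" by simp
  then show ?thesis unfolding unit_root_def Complex.DeMoivre by (simp only: cis_multiple_2pi[OF Ints_of_nat])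
qed

lemma unit_root_nonzero [simp]: "unit_root m l \<noteq> 0" by (simp add: unit_root_def)

lemma unit_root_inj: "l < m \<Longrightarrow> l' < m \<Longrightarrow> unit_root m l = unit_root m l' \<Longrightarrow> l = l'"
  using Complex.bij_betw_roots_unity[of m] unfolding unit_root_def bij_betw_def inj_on_def by auto

lemma power_mod_order: "z ^ m = (1::'a::monoid_mult) \<Longrightarrow> z ^ (a mod m) = z ^ a"
  by (metis mod_mult_div_eq mult.commute power_add power_mult power_one mult_1_right)

definition dft :: "nat \<Rightarrow> complex Matrix.mat" where
  "dft m = Matrix.mat m m (\<lambda>(j, l). unit_root m l ^ j)"

text \<open>
  By the orthogonality of characters, the product with the conjugate transpose is \<open>m\<close> times the
  identity.
\<close>
lemma det_dft_nonzero: "Determinant.det (dft m) \<noteq> 0"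
proof (cases "m = 0")
  case True
  then show ?thesis by (simp add: dft_def)
next
  case False
  let ?G = "Matrix.mat m m (\<lambda>(l, j). inverse (unit_root m l) ^ j)"
  have "?G * dft m = of_nat m \<cdot>\<^sub>m 1\<^sub>m m"
  proof (rule eq_matI)
    fix l l' assume "l < dim_row (of_nat m \<cdot>\<^sub>m 1\<^sub>m m :: complex Matrix.mat)"
      "l' < dim_col (of_nat m \<cdot>\<^sub>m 1\<^sub>m m :: complex Matrix.mat)"
    then have l: "l < m" "l' < m" by auto
    let ?z = "unit_root m l' / unit_root m l"
    have "(?G * dft m) $$ (l, l') = (\<Sum>j = 0..<m. ?z ^ j)"
      using l by (auto simp: dft_def scalar_prod_def power_divide field_simps intro!: sum.cong)
    also have "\<dots> = (if l = l' then of_nat m else 0)"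
    proof (cases "l = l'")
      case False
      then have "?z \<noteq> 1" using unit_root_inj[of l' m l] l by auto
      moreover have "?z ^ m = 1" using \<open>m \<noteq> 0\<close> by (simp add: power_divide unit_root_power_order)
      ultimately show ?thesis using False geometric_sum[of ?z m] by (simp add: atLeast0LessThan)
    qed simp
    finally show "(?G * dft m) $$ (l, l') = (of_nat m \<cdot>\<^sub>m 1\<^sub>m m) $$ (l, l')" using l by simp
  qed (simp_all add: dft_def)
  then have "Determinant.det ?G * Determinant.det (dft m) = of_nat m ^ m"
    by (subst det_mult[symmetric]) (auto simp: dft_def)
  then show ?thesis using False by auto
qed

text \<open>
  The columns of the Fourier matrix are eigenvectors, because translation by \<open>d\<close> multiplies the
  character \<open>j \<mapsto> w\<^sup>j\<close> by \<open>w\<^sup>d\<close>.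
\<close>
lemma det_circulant_laplacian:
  assumes m: "m > 0" and N: "\<And>i. i < m \<Longrightarrow> N i = (\<lambda>d. (i + d) mod m) ` S"
    and S: "S \<subseteq> {1..<m}"
  shows "Determinant.det (Matrix.mat m m (\<lambda>(i, j). \<Sum>u\<in>insert i (N i). choice_row x i u j)) =
    (\<Prod>l<m. x + (\<Sum>d\<in>S. 1 - unit_root m l ^ d))"
proof -
  let ?M = "Matrix.mat m m (\<lambda>(i, j). \<Sum>u\<in>insert i (N i). choice_row x i u j)"
  define ev where "ev l = x + (\<Sum>d\<in>S. 1 - unit_root m l ^ d)" for l
  let ?D = "Matrix.mat m m (\<lambda>(i, j). if i = j then ev i else 0)"
  have finS: "finite S" using S finite_subset by blast
  have inj: "inj_on (\<lambda>d. (i + d) mod m) S" for i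
  proof (rule inj_onI)
    fix a b assume ab: "a \<in> S" "b \<in> S" "(i + a) mod m = (i + b) mod m"
    then have "[a = b] (mod m)" by (simp add: cong_def[symmetric] cong_add_lcancel_nat)
    moreover have "a < m" "b < m" using ab S by auto
    ultimately show "a = b" by (simp add: cong_def)
  qed
  have row: "(\<Sum>j<m. choice_row x i u j * z j) = (if u = i then x * z i else z i - z u)"
    if "i < m" "u < m" for i u and z :: "nat \<Rightarrow> complex"
  proof (cases "u = i")
    case True
    then have "(\<Sum>j<m. choice_row x i u j * z j) = (\<Sum>j<m. if j = i then x * z i else 0)"
      by (intro sum.cong) (auto simp: choice_row_def)
    then show ?thesis using True that by simp
  next
    case False
    then have "(\<Sum>j<m. choice_row x i u j * z j) =
        (\<Sum>j<m. (if j = i then z i else 0) - (if j = u then z u else 0))"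
      by (intro sum.cong) (auto simp: choice_row_def)
    then show ?thesis using False that by (simp add: sum_subtractf)
  qed
  have "?M * dft m = dft m * ?D"
  proof (rule eq_matI)
    fix i l assume "i < dim_row (dft m * ?D)" "l < dim_col (dft m * ?D)"
    then have il: "i < m" "l < m" by (auto simp: dft_def)
    let ?w = "unit_root m l"
    have wm: "?w ^ m = 1" using m by (rule unit_root_power_order)
    have iN: "i \<notin> N i"
    proof
      assume "i \<in> N i"
      then obtain d where d: "d \<in> S" "(i + d) mod m = i" using N[OF il(1)] by auto
      have "[i + d = i + 0] (mod m)" using d il by (simp add: cong_def)
      then have "[d = 0] (mod m)" by (simp only: cong_add_lcancel_nat)
      moreover have "0 < d" "d < m" using d(1) S by auto
      ultimately show False by (simp add: cong_def)
    qed
    have Nm: "u < m" if "u \<in> N i" for u using that N[OF il(1)] m by auto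
    have finN: "finite (N i)" using N[OF il(1)] finS by simp
    have "(?M * dft m) $$ (i, l) = (\<Sum>j<m. (\<Sum>u\<in>insert i (N i). choice_row x i u j) * ?w ^ j)"
      using il by (auto simp: dft_def scalar_prod_def atLeast0LessThan intro!: sum.cong)
    also have "\<dots> = (\<Sum>u\<in>insert i (N i). \<Sum>j<m. choice_row x i u j * ?w ^ j)"
      by (subst sum.swap) (simp add: sum_distrib_right)
    also have "\<dots> = (\<Sum>u\<in>insert i (N i). if u = i then x * ?w ^ i else ?w ^ i - ?w ^ u)"
      using il Nm by (intro sum.cong row refl) auto
    also have "\<dots> = x * ?w ^ i + (\<Sum>u\<in>N i. ?w ^ i - ?w ^ u)"
      using iN finN by (auto intro!: sum.cong)
    also have "(\<Sum>u\<in>N i. ?w ^ i - ?w ^ u) = (\<Sum>d\<in>S. ?w ^ i - ?w ^ (i + d))"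
      unfolding N[OF il(1)] using inj[of i] by (simp add: sum.reindex power_mod_order[OF wm])
    also have "x * ?w ^ i + \<dots> = ?w ^ i * ev l"
      by (simp add: ev_def power_add sum_distrib_left sum_distrib_right algebra_simps)
    also have "\<dots> = (\<Sum>k<m. if k = l then unit_root m k ^ i * ev k else 0)" using il by simp
    also have "\<dots> = (\<Sum>k<m. unit_root m k ^ i * (if k = l then ev k else 0))"
      by (intro sum.cong) auto
    also have "\<dots> = (dft m * ?D) $$ (i, l)"
      using il by (simp add: dft_def scalar_prod_def atLeast0LessThan)
    finally show "(?M * dft m) $$ (i, l) = (dft m * ?D) $$ (i, l)" .
  qed (auto simp: dft_def)
  then have "Determinant.det ?M * Determinant.det (dft m) = Determinant.det (dft m) * Determinant.det ?D"
    by (subst (1 2) det_mult[symmetric, of _ m]) (auto simp: dft_def)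
  then have "Determinant.det ?M = Determinant.det ?D" using det_dft_nonzero[of m] by simp
  also have "\<dots> = (\<Prod>l<m. ev l)"
    by (subst det_upper_triangular[of _ m])
       (auto simp: prod_list_diag_prod atLeast0LessThan intro!: upper_triangularI prod.cong)
  finally show ?thesis by (simp add: ev_def)
qed

lemma cong_shift_iff:
  assumes "i < m" "j < m" "d < m"
  shows "[int j = int i + int d] (mod int m) \<longleftrightarrow> j = (i + d) mod m"
    and "[int j = int i - int d] (mod int m) \<longleftrightarrow> j = (i + (m - d)) mod m"
proof -
  have "[int j = int i + int d] (mod int m) \<longleftrightarrow> [j = i + d] (mod m)"
    by (simp add: cong_int_iff flip: of_nat_add)
  then show "[int j = int i + int d] (mod int m) \<longleftrightarrow> j = (i + d) mod m"
    using assms by (simp add: cong_def)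
  have "[int j = int i - int d] (mod int m) \<longleftrightarrow> [int j = int i - int d + int m] (mod int m)"
    by (simp add: cong_def)
  also have "int i - int d + int m = int (i + (m - d))" using assms by (simp add: of_nat_diff)
  also have "[int j = \<dots>] (mod int m) \<longleftrightarrow> [j = i + (m - d)] (mod m)"
    by (simp only: cong_int_iff)
  finally show "[int j = int i - int d] (mod int m) \<longleftrightarrow> j = (i + (m - d)) mod m"
    using assms by (simp add: cong_def)
qed

text \<open>
  Replacing a jump \<open>-d\<close> by \<open>m - d\<close> describes the neighbourhoods by positive jumps only. The union
  removes the duplicate for \<open>d = m - d\<close>, in accordance with edges being a set.
\<close>
lemma circulant_neighbours:
  assumes "i < m" and D: "D \<subseteq> {1..<m}"
  shows "{u. u < m \<and> {i, u} \<in> circulant_edges m D} = (\<lambda>d. (i + d) mod m) ` (D \<union> (\<lambda>d. m - d) ` D)"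
proof -
  have m: "m > 0" using assms(1) by simp
  have ne: "(i + d) mod m \<noteq> i" if "d \<in> D \<union> (\<lambda>d. m - d) ` D" for d
  proof
    assume "(i + d) mod m = i"
    then have "[i + d = i + 0] (mod m)" using assms by (simp add: cong_def)
    then have "[d = 0] (mod m)" by (simp only: cong_add_lcancel_nat)
    moreover have "0 < d" "d < m" using that D by auto
    ultimately show False by (simp add: cong_def)
  qed
  have sym: "[int a = int b - int d] (mod int m) \<longleftrightarrow> [int b = int a + int d] (mod int m)" for a b d
    by (metis cong_add_rcancel cong_sym_eq diff_add_cancel)
  have sym': "[int a = int b + int d] (mod int m) \<longleftrightarrow> [int b = int a - int d] (mod int m)" for a b d
    using sym[of b a d] by blast
  have "{i, u} \<in> circulant_edges m D \<longleftrightarrow> i \<noteq> u \<and>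
      (\<exists>d\<in>D. [int u = int i + int d] (mod int m) \<or> [int u = int i - int d] (mod int m))"
    if "u < m" for u
    unfolding circulant_edges_def using assms(1) that sym sym'
    by (auto simp: doubleton_eq_iff)
  also have "\<dots> u \<longleftrightarrow> i \<noteq> u \<and> (\<exists>d\<in>D. u = (i + d) mod m \<or> u = (i + (m - d)) mod m)" if "u < m" for u
    using cong_shift_iff[OF assms(1) that] D by (metis atLeastLessThan_iff subsetD)
  finally show ?thesis using m ne by (auto simp: image_Un image_image) (metis UnCI imageI)+
qed

theorem spanning_trees_circulant:
  assumes m: "m > 0" and D: "D \<subseteq> {1..<m}"
  shows "of_nat (m * num_spanning_trees {..<m} (circulant_edges m D)) =
    (\<Prod>l=1..<m. \<Sum>d\<in>D \<union> (\<lambda>d. m - d) ` D. 1 - unit_root m l ^ d)"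
proof (rule spanning_trees_eq_prod_eigenvalues)
  show "simple_graph {..<m} (circulant_edges m D)"
    unfolding simple_graph_def circulant_edges_def by blast
  show "(\<Sum>d\<in>D \<union> (\<lambda>d. m - d) ` D. 1 - unit_root m 0 ^ d) = 0"
    by (simp add: unit_root_def)
  have "D \<union> (\<lambda>d. m - d) ` D \<subseteq> {1..<m}" using D by force
  then show "Determinant.det (Matrix.mat m m (\<lambda>(i, j).
      \<Sum>u\<in>insert i {u. u < m \<and> {i, u} \<in> circulant_edges m D}. choice_row x i u j)) =
    (\<Prod>l<m. x + (\<Sum>d\<in>D \<union> (\<lambda>d. m - d) ` D. 1 - unit_root m l ^ d))" for x
    using circulant_neighbours[OF _ D] by (intro det_circulant_laplacian m) auto
qed (rule m)

section \<open>Connectedness of circulant graphs\<close>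

text \<open>
  A subgroup of the integers that contains \<open>A\<close> contains its greatest common divisor, by
  Bezout. This is used for the translations that preserve reachability, and for the exponents that
  annihilate a complex number.
\<close>
lemma Gcd_closed_under_group:
  fixes P :: "int \<Rightarrow> bool" and A :: "nat set"
  assumes "finite A" and A: "\<And>a. a \<in> A \<Longrightarrow> P (int a)"
    and zero: "P 0" and add: "\<And>x y. P x \<Longrightarrow> P y \<Longrightarrow> P (x + y)" and neg: "\<And>x. P x \<Longrightarrow> P (- x)"
  shows "P (int (Gcd A))"
proof -
  have nat_mult: "P (int c * x)" if "P x" for c x
    by (induction c) (use zero add that in \<open>auto simp: distrib_right\<close>)
  have int_mult: "P (c * x)" if "P x" for c x
    using nat_mult[OF that, of "nat c"] neg[OF nat_mult[OF that, of "nat (- c)"]]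
    by (cases "c \<ge> 0") auto
  show ?thesis
    using assms(1) A
  proof (induction A rule: finite_induct)
    case empty
    then show ?case using zero by simp
  next
    case (insert a A)
    obtain u v where uv: "u * int a + v * int (Gcd A) = gcd (int a) (int (Gcd A))"
      using bezout_int by blast
    have "P (u * int a + v * int (Gcd A))" using insert by (intro add int_mult) auto
    then show ?case unfolding uv by simp
  qed
qed

text \<open>
  The residue of a vertex modulo the greatest common divisor of \<open>m\<close> and the jumps is constant along
  edges, and if \<open>m > 1\<close> then \<open>0\<close> and \<open>1\<close> are both vertices.
\<close>
lemma circulant_connected_imp_Gcd:
  assumes conn: "graph_connected {..<m} (circulant_edges m D)"
  shows "Gcd (insert m D) = 1"
proof (cases "m = 1")
  case False
  let ?g = "Gcd (insert m D)"
  have m: "0 < m" using conn by (cases m) (auto simp: graph_connected_def)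
  have edge: "[int u = int v] (mod int ?g)" if "{u, v} \<in> circulant_edges m D" for u v
  proof -
    obtain i j d where ij: "{u, v} = {i, j}" "d \<in> D"
      and c: "[int j = int i + int d] (mod int m) \<or> [int j = int i - int d] (mod int m)"
      using \<open>{u, v} \<in> _\<close> unfolding circulant_edges_def by auto
    have "?g dvd m" "?g dvd d" using ij by (intro Gcd_dvd; simp)+
    then have g: "int ?g dvd int m" "[int d = 0] (mod int ?g)" by (auto simp: cong_0_iff)
    have "[int j = int i] (mod int ?g)" using c
    proof
      assume "[int j = int i + int d] (mod int m)"
      then have "[int j = int i + int d] (mod int ?g)" using g(1) by (rule cong_dvd_modulus)
      also have "[int i + int d = int i + 0] (mod int ?g)" by (intro cong_add cong_refl g(2))
      finally show ?thesis by simp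
    next
      assume "[int j = int i - int d] (mod int m)"
      then have "[int j = int i - int d] (mod int ?g)" using g(1) by (rule cong_dvd_modulus)
      also have "[int i - int d = int i - 0] (mod int ?g)" by (intro cong_diff cong_refl g(2))
      finally show ?thesis by simp
    qed
    then show ?thesis using ij by (auto simp: doubleton_eq_iff cong_sym)
  qed
  have "(0, 1) \<in> {(x, y). {x, y} \<in> circulant_edges m D}\<^sup>*"
    using conn False m by (simp add: graph_connected_def)
  then have "[int 0 = int 1] (mod int ?g)"
  proof (induction rule: rtrancl_induct)
    case (step y z)
    then show ?case using edge[of y z] cong_trans by blast
  qed simp
  then have "int ?g dvd 1" by (simp add: cong_sym_eq cong_0_iff)
  then show ?thesis by simp
qed simp

text \<open>
  The translations \<open>h\<close> for which every vertex \<open>i\<close> is joined to \<open>i + h\<close> by a path form a group that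
  contains \<open>m\<close> and all jumps.
\<close>
lemma circulant_connected_if_Gcd:
  assumes m: "m > 0" and D: "D \<subseteq> {1..<m}" and Gcd: "Gcd (insert m D) = 1"
  shows "graph_connected {..<m} (circulant_edges m D)"
proof -
  let ?R = "{(x, y). {x, y} \<in> circulant_edges m D}"
  define shift where "shift i h = nat ((int i + h) mod int m)" for i h
  have shift_less: "shift i h < m" for i h using m by (simp add: shift_def nat_less_iff)
  have int_shift: "int (shift i h) = (int i + h) mod int m" for i h using m by (simp add: shift_def)
  have shift_shift: "shift (shift i h) h' = shift i (h + h')" for i h h'
    unfolding shift_def[of "shift i h"] int_shift by (simp add: shift_def mod_add_left_eq add.assoc)
  have shift_0: "shift i 0 = i" if "i < m" for i using that by (simp add: shift_def)
  define P where "P h \<longleftrightarrow> (\<forall>i<m. (i, shift i h) \<in> ?R\<^sup>*)" for h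
  have "P (int (Gcd (insert m D)))"
  proof (rule Gcd_closed_under_group)
    show "finite (insert m D)" using D finite_subset by blast
    show "P 0" by (simp add: P_def shift_0)
    show "P (x + y)" if "P x" "P y" for x y
    proof -
      have "(i, shift i (x + y)) \<in> ?R\<^sup>*" if i: "i < m" for i
      proof -
        have "(i, shift i x) \<in> ?R\<^sup>*" using \<open>P x\<close> i by (simp add: P_def)
        moreover have "(shift i x, shift (shift i x) y) \<in> ?R\<^sup>*"
          using \<open>P y\<close> shift_less by (simp add: P_def)
        ultimately show ?thesis unfolding shift_shift by (rule rtrancl_trans)
      qed
      then show ?thesis by (simp add: P_def)
    qed
    show "P (- x)" if "P x" for x
    proof -
      have "(i, shift i (- x)) \<in> ?R\<^sup>*" if i: "i < m" for i
      proof -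
        have "(shift i (- x), shift (shift i (- x)) x) \<in> ?R\<^sup>*"
          using \<open>P x\<close> shift_less by (simp add: P_def)
        then have "(shift i (- x), i) \<in> ?R\<^sup>*" unfolding shift_shift using i by (simp add: shift_0)
        then show ?thesis by (rule symD[OF sym_reachability])
      qed
      then show ?thesis by (simp add: P_def)
    qed
    show "P (int a)" if a: "a \<in> insert m D" for a
    proof (cases "a = m")
      case True
      then show ?thesis by (simp add: P_def shift_def)
    next
      case False
      then have a: "a \<in> D" "0 < a" "a < m" using a D by auto
      have "(i, shift i (int a)) \<in> ?R" if i: "i < m" for i
      proof -
        have sh: "shift i (int a) = (i + a) mod m"
          by (simp add: shift_def flip: of_nat_add zmod_int)
        have "(i + a) mod m \<noteq> i"
        proof
          assume "(i + a) mod m = i"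
          then have "[i + a = i + 0] (mod m)" using i by (simp add: cong_def)
          then have "[a = 0] (mod m)" by (simp only: cong_add_lcancel_nat)
          then show False using a by (simp add: cong_def)
        qed
        then show ?thesis
          unfolding circulant_edges_def sh using i a cong_shift_iff(1)[of i m "(i + a) mod m" a] m
          by (intro CollectI case_prodI exI[of _ i] exI[of _ "(i + a) mod m"] conjI bexI[of _ a] disjI1) auto
      qed
      then show ?thesis by (auto simp: P_def)
    qed
  qed
  then have P1: "P 1" using Gcd by simp
  have step: "P (int c)" for c
  proof -
    have "(i, shift i (int c)) \<in> ?R\<^sup>*" if i: "i < m" for i
    proof (induction c)
      case (Suc c)
      have "(shift i (int c), shift (shift i (int c)) 1) \<in> ?R\<^sup>*"
        using P1 shift_less by (simp add: P_def)
      then show ?case using Suc unfolding shift_shift by (simp add: add.commute)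
    qed (simp add: shift_0 i)
    then show ?thesis by (simp add: P_def)
  qed
  have "(u, v) \<in> ?R\<^sup>*" if "u < m" "v < m" for u v
  proof -
    have "shift u (int (v + (m - u))) = v"
      using that by (simp add: shift_def of_nat_diff)
    then show ?thesis using step[of "v + (m - u)"] that by (auto simp: P_def)
  qed
  then show ?thesis using m by (auto simp: graph_connected_def)
qed

section \<open>The logarithm of \<open>\<bar>1 - z\<bar>\<close> on the unit circle\<close>

definition circle_log :: "real \<Rightarrow> real" where
  "circle_log t = ln (norm (1 - cis (2 * pi * t)))"

lemma norm_one_minus_cis: "norm (1 - cis (2 * x)) = 2 * \<bar>sin x\<bar>"
proof -
  have "(norm (1 - cis (2 * x)))\<^sup>2 = (1 - cos (2 * x))\<^sup>2 + (sin (2 * x))\<^sup>2"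
    by (simp add: cmod_power2)
  also have "\<dots> = 2 - 2 * cos (2 * x)"
    using sin_cos_squared_add[of "2 * x"] by (simp add: power2_diff)
  also have "\<dots> = (2 * \<bar>sin x\<bar>)\<^sup>2"
    by (simp add: cos_double_sin power_mult_distrib)
  finally show ?thesis by (rule power2_eq_imp_eq) auto
qed

text \<open>
  The sine is concave on \<open>[0, \<pi>/2]\<close>, hence lies above its chord; the other half is symmetric. The
  bound is chosen for its logarithm, which is the integrable function \<open>ln t + ln (1 - t)\<close>.
\<close>
lemma sin_pi_lower_bound:
  assumes "0 \<le> t" "t \<le> 1"
  shows "t * (1 - t) \<le> sin (pi * t)"
proof -
  have conv: "convex_on {0..pi / 2} (\<lambda>x. - sin x)"
    by (rule f''_ge0_imp_convex[where f' = "\<lambda>x. - cos x" and f'' = sin])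
       (auto intro!: derivative_eq_intros sin_ge_zero)
  \<comment> \<open>\<open>\<pi>u\<close> is the convex combination of \<open>0\<close> and \<open>\<pi>/2\<close> with weight \<open>2u\<close>\<close>
  have half: "2 * u \<le> sin (pi * u)" if "0 \<le> u" "u \<le> 1 / 2" for u
    using convex_onD[OF conv, of "2 * u" 0 "pi / 2"] that by (simp add: mult.commute)
  show ?thesis
  proof (cases "t \<le> 1 / 2")
    case True
    have "t * (1 - t) \<le> t * 1" using assms by (intro mult_left_mono) auto
    then show ?thesis using half[of t] True assms by linarith
  next
    case False
    have "t * (1 - t) \<le> 1 * (1 - t)" using assms by (intro mult_right_mono) auto
    moreover have "sin (pi * (1 - t)) = sin (pi * t)"
      by (simp add: right_diff_distrib sin_diff)
    moreover have "2 * (1 - t) \<le> sin (pi * (1 - t))" using False assms by (intro half) auto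
    ultimately show ?thesis using assms by simp
  qed
qed

lemma ln_integrable_01: "ln integrable_on {0..1::real}"
proof -
  define F :: "real \<Rightarrow> real" where "F t = t * ln t - t" for t
  have "continuous_on {0..1} F"
  proof (rule continuous_on_IccI)
    show "(F \<longlongrightarrow> F 0) (at_right 0)" unfolding F_def by simp real_asymp
    show "(F \<longlongrightarrow> F 1) (at_left 1)" unfolding F_def by (auto intro!: tendsto_eq_intros)
    show "F \<midarrow>x\<rightarrow> F x" if "0 < x" "x < 1" for x
      unfolding F_def using that by (auto intro!: tendsto_eq_intros)
  qed simp
  moreover have "(F has_vector_derivative ln x) (at x)" if "x \<in> {0<..<1}" for x
    unfolding F_def using that
    by (auto intro!: derivative_eq_intros simp flip: has_real_derivative_iff_has_vector_derivative)
  ultimately have "(ln has_integral (F 1 - F 0)) {0..1}"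
    by (intro fundamental_theorem_of_calculus_interior) auto
  then show ?thesis by blast
qed

lemma ln_reflected_integrable_01: "(\<lambda>t::real. ln (1 - t)) integrable_on {0..1}"
proof -
  have "(\<lambda>x. - 1 * x + 1) ` {0..1::real} = {0..1}"
    by (subst image_affinity_atLeastAtMost) auto
  then show ?thesis
    using integrable_affinity[of ln "0::real" 1 "-1" 1] ln_integrable_01 by (simp add: cbox_interval)
qed

lemma circle_log_le: "circle_log t \<le> ln 2"
proof (cases "norm (1 - cis (2 * pi * t)) = 0")
  case False
  have "norm (1 - cis (2 * pi * t)) \<le> 2" using norm_triangle_ineq4[of 1 "cis (2 * pi * t)"] by simp
  then show ?thesis unfolding circle_log_def using False by (subst ln_le_cancel_iff) (auto simp: less_le)
qed (simp add: circle_log_def)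

lemma circle_log_measurable: "circle_log \<in> borel_measurable borel"
proof -
  have "(\<lambda>t. norm (1 - cis (2 * pi * t))) \<in> borel_measurable borel"
    by (intro borel_measurable_continuous_onI continuous_intros)
  then show ?thesis unfolding circle_log_def by (rule borel_measurable_ln)
qed

lemma circle_log_integrable: "circle_log integrable_on {0..1}"
proof (rule measurable_bounded_by_integrable_imp_integrable)
  show "circle_log \<in> borel_measurable (lebesgue_on {0..1})"
    using circle_log_measurable by (simp add: measurable_completion measurable_restrict_space1)
  show "(\<lambda>t. ln 2 - ln t - ln (1 - t)) integrable_on {0..1::real}"
    using ln_integrable_01 ln_reflected_integrable_01 by (intro integrable_diff) auto
  \<comment> \<open>at the end points the convention \<open>ln 0 = 0\<close> applies on both sides\<close>
  show "norm (circle_log t) \<le> ln 2 - ln t - ln (1 - t)" if t: "t \<in> {0..1}" for t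
  proof (cases "t = 0 \<or> t = 1")
    case True
    then show ?thesis by (auto simp: circle_log_def)
  next
    case False
    then have t: "0 < t" "t < 1" using t by auto
    have "t * (1 - t) \<le> sin (pi * t)" using t by (intro sin_pi_lower_bound) auto
    moreover have pos: "0 < t * (1 - t)" using t by simp
    ultimately have "t * (1 - t) \<le> norm (1 - cis (2 * pi * t))"
      using norm_one_minus_cis[of "pi * t"] by (simp add: mult.assoc)
    then have "ln (t * (1 - t)) \<le> circle_log t"
      unfolding circle_log_def using pos by (subst ln_le_cancel_iff) auto
    moreover have "ln (t * (1 - t)) = ln t + ln (1 - t)" using t by (simp add: ln_mult)
    moreover have "ln t \<le> 0" "ln (1 - t) \<le> 0" "0 < ln (2::real)" using t by auto
    ultimately show ?thesis using circle_log_le[of t] unfolding real_norm_def by linarith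
  qed
qed simp

lemma has_integral_affine:
  fixes f :: "real \<Rightarrow> real"
  assumes "(f has_integral I) {m * a + c..m * b + c}" "m > 0"
  shows "((\<lambda>t. f (m * t + c)) has_integral I / m) {a..b}"
  using has_integral_affinity'[of f I "m * a + c" "m * b + c" m c] assms
  by (simp add: field_simps)

text \<open>
  The duplication formula \<open>1 - w\<^sup>2 = (1 - w)(1 + w)\<close>, where \<open>- w\<close> is \<open>w\<close> rotated by half a turn.
\<close>
lemma circle_log_double:
  assumes "0 < t" "t < 1 / 2"
  shows "circle_log (2 * t) = circle_log t + circle_log (t + 1 / 2)"
proof -
  let ?w = "cis (2 * pi * t)"
  have w': "cis (2 * pi * (t + 1 / 2)) = - ?w"
    by (simp add: distrib_left flip: cis_mult)
  have sin: "sin (2 * pi * t) > 0" using assms by (intro sin_gt_zero) auto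
  have "?w \<noteq> 1" "?w \<noteq> - 1" using sin by (auto simp: complex_eq_iff)
  then have nz: "norm (1 - ?w) > 0" "norm (1 + ?w) > 0" by (auto simp: add_eq_0_iff)
  have "cis (2 * pi * (2 * t)) = ?w * ?w" by (simp add: cis_mult)
  then have "1 - cis (2 * pi * (2 * t)) = (1 - ?w) * (1 + ?w)" by (simp add: algebra_simps)
  then have "norm (1 - cis (2 * pi * (2 * t))) = norm (1 - ?w) * norm (1 + ?w)"
    by (simp add: norm_mult)
  then show ?thesis unfolding circle_log_def w' using nz by (simp add: ln_mult)
qed

text \<open>
  Integrate the duplication formula over \<open>[0, 1/2]\<close>: the right-hand side gives the whole integral \<open>I\<close>,
  the left-hand side gives \<open>I/2\<close> by substitution. So \<open>I = 0\<close>.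
\<close>
lemma circle_log_has_integral: "(circle_log has_integral 0) {0..1}"
proof -
  define I where "I = integral {0..1} circle_log"
  have I: "(circle_log has_integral I) {0..1}"
    unfolding I_def using circle_log_integrable by (rule integrable_integral)
  have part: "circle_log integrable_on {0..1/2}" "circle_log integrable_on {1/2..1}"
    using integrable_on_subinterval[OF circle_log_integrable] by auto
  have split: "integral {0..1/2} circle_log + integral {1/2..1} circle_log = I"
    unfolding I_def using circle_log_integrable by (intro Henstock_Kurzweil_Integration.integral_combine) auto
  have "((\<lambda>t. circle_log (1 * t + 1/2)) has_integral integral {1/2..1} circle_log / 1) {0..1/2}"
    by (rule has_integral_affine) (use part(2) in \<open>auto simp: has_integral_integral\<close>)
  then have "((\<lambda>t. circle_log t + circle_log (t + 1/2)) has_integral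
      (integral {0..1/2} circle_log + integral {1/2..1} circle_log)) {0..1/2}"
    using part(1) by (intro has_integral_add) (auto simp: has_integral_integral)
  then have doubled: "((\<lambda>t. circle_log (2 * t)) has_integral
      (integral {0..1/2} circle_log + integral {1/2..1} circle_log)) {0..1/2}"
    by (rule has_integral_spike_finite[of "{0, 1/2}", rotated 2]) (auto simp: circle_log_double)
  have "((\<lambda>t. circle_log (2 * t + 0)) has_integral I / 2) {0..1/2}"
    by (rule has_integral_affine) (use I in auto)
  then have "((\<lambda>t. circle_log (2 * t)) has_integral I / 2) {0..1/2}" by simp
  from has_integral_unique[OF doubled this] split have "I = 0" by linarith
  then show ?thesis using I by simp
qed

lemma circle_log_periodic: "circle_log (t + real N) = circle_log t"
proof -
  have "cis (2 * pi * (t + real N)) = cis (2 * pi * t) * cis (2 * pi * real N)"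
    by (simp only: cis_mult distrib_left)
  also have "cis (2 * pi * real N) = 1" by (rule cis_multiple_2pi) simp
  finally show ?thesis by (simp add: circle_log_def)
qed

lemma circle_log_dilated_has_integral:
  assumes "g > 0"
  shows "((\<lambda>t. circle_log (real g * t)) has_integral 0) {0..1}"
proof -
  have "(circle_log has_integral 0) {0..real N}" for N
  proof (induction N)
    case (Suc N)
    have "((\<lambda>t. circle_log (1 * t + - real N)) has_integral 0 / 1) {real N..real (Suc N)}"
      by (rule has_integral_affine) (use circle_log_has_integral in auto)
    then have "(circle_log has_integral 0) {real N..real (Suc N)}"
      using circle_log_periodic[of "_ - real N" N] by simp
    from has_integral_combine[OF _ _ Suc this] show ?case by simp
  qed (auto simp: has_integral_refl)
  from this[of g] have "((\<lambda>t. circle_log (real g * t + 0)) has_integral 0 / real g) {0..1}"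
    by (intro has_integral_affine) (use assms in auto)
  then show ?thesis by simp
qed

text \<open>
  If \<open>g\<close> is coprime to \<open>n\<close>, then \<open>z = exp (2\<pi>\<i>g/n)\<close> is again a primitive root, so that
  \<open>1 + x + \<dots> + x\<^bsup>n-1\<^esup> = \<Prod>\<^sub>l (x - z\<^sup>l)\<close>; evaluate at \<open>x = 1\<close>.
\<close>
lemma prod_one_minus_dilated_roots:
  assumes n: "n > 0" and co: "coprime g n"
  shows "(\<Prod>l=1..<n. 1 - cis (2 * pi * (real g * (real l / real n)))) = of_nat n"
proof -
  define z where "z = unit_root n g"
  have zl: "cis (2 * pi * (real g * (real l / real n))) = z ^ l" for l
    unfolding z_def unit_root_def Complex.DeMoivre by (simp add: mult_ac)
  have inj: "inj_on (\<lambda>l. z ^ l) {..<n}"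
  proof (rule inj_onI)
    fix a b assume ab: "a \<in> {..<n}" "b \<in> {..<n}" "z ^ a = z ^ b"
    have pow: "z ^ l = unit_root n (g * l mod n)" for l
    proof -
      have "z ^ l = unit_root n 1 ^ (g * l)"
        unfolding z_def unit_root_def Complex.DeMoivre by (simp add: mult_ac)
      also have "\<dots> = unit_root n 1 ^ (g * l mod n)"
        using power_mod_order[OF unit_root_power_order[OF n]] by metis
      also have "\<dots> = unit_root n (g * l mod n)"
        unfolding unit_root_def Complex.DeMoivre by (simp add: mult_ac)
      finally show ?thesis .
    qed
    have "g * a mod n = g * b mod n"
      using ab(3) n unfolding pow by (intro unit_root_inj[of _ n]) auto
    then have "[a = b] (mod n)" using co by (simp add: cong_mult_lcancel_nat flip: cong_def)
    then show "a = b" using ab by (simp add: cong_def)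
  qed
  have zn: "z ^ n = 1" unfolding z_def using n by (rule unit_root_power_order)
  \<comment> \<open>\<open>p\<close> and \<open>q\<close> are monic of degree \<open>n - 1\<close> and vanish at the \<open>n - 1\<close> distinct numbers \<open>z\<^sup>l\<close> with \<open>0 < l < n\<close>\<close>
  define p :: "complex poly" where "p = (\<Sum>j<n. monom 1 j)"
  define q where "q = (\<Prod>l=1..<n. [:- (z ^ l), 1:])"
  have degq: "degree q = n - 1" unfolding q_def by (subst degree_prod_eq_sum_degree) auto
  have "p = q"
  proof (rule poly_eqI_degree_lead_coeff)
    show "coeff p (n - 1) = coeff q (n - 1)"
    proof -
      have "coeff q (n - 1) = lead_coeff q" by (simp add: degq)
      also have "\<dots> = 1" by (simp add: q_def lead_coeff_prod)
      finally show ?thesis using n by (simp add: p_def coeff_sum)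
    qed
    have "card ((\<lambda>l. z ^ l) ` {1..<n}) = n - 1"
      by (subst card_image) (auto intro: inj_on_subset[OF inj])
    then show "n - 1 \<le> card ((\<lambda>l. z ^ l) ` {1..<n})" by simp
    show "degree p \<le> n - 1" unfolding p_def
      by (intro degree_sum_le) (auto intro: order_trans[OF degree_monom_le])
    show "degree q \<le> n - 1" by (simp add: degq)
    show "poly p x = poly q x" if x: "x \<in> (\<lambda>l. z ^ l) ` {1..<n}" for x
    proof -
      obtain l where l: "x = z ^ l" "1 \<le> l" "l < n" using x by auto
      have "z ^ l \<noteq> z ^ 0" using inj l by (metis inj_onD lessThan_iff not_one_le_zero n)
      then have "x \<noteq> 1" using l by simp
      moreover have "x ^ n = 1" using zn unfolding l by (metis power_mult mult.commute power_one)
      ultimately have "poly p x = 0" by (simp add: p_def poly_sum poly_monom geometric_sum)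
      moreover have "poly q x = 0" unfolding q_def poly_prod using l by (intro prod_zero) auto
      ultimately show ?thesis by simp
    qed
  qed
  then have "poly p 1 = poly q 1" by simp
  then show ?thesis unfolding zl by (simp add: p_def q_def poly_sum poly_prod poly_monom)
qed

section \<open>Riemann sums\<close>

text \<open>
  The sample points \<open>(l + \<theta>)/n\<close> with \<open>\<theta> = 0\<close> and \<open>\<theta> = 1/2\<close> are the two sets of points at which the
  eigenvalues of the even circulant graphs are taken. By uniform continuity the function varies little
  on each interval of length \<open>1/n\<close>.
\<close>
lemma riemann_sum_tendsto:
  fixes G :: "real \<Rightarrow> real"
  assumes G: "continuous_on {0..1} G" and \<theta>: "0 \<le> \<theta>" "\<theta> \<le> 1"
  shows "(\<lambda>n. (\<Sum>l<n. G ((real l + \<theta>) / real n)) / real n) \<longlonglongrightarrow> integral {0..1} G"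
proof (rule LIMSEQ_I)
  fix e :: real assume e: "e > 0"
  have "uniformly_continuous_on {0..1} G" using G by (simp add: compact_uniformly_continuous)
  then obtain d where d: "d > 0"
    "\<And>x y. x \<in> {0..1} \<Longrightarrow> y \<in> {0..1} \<Longrightarrow> dist y x < d \<Longrightarrow> dist (G y) (G x) < e / 2"
    using e unfolding uniformly_continuous_on_def by (meson half_gt_zero)
  obtain N :: nat where N: "N > 0" "1 / real N < d"
    using d(1) by (metis nat_approx_posE inverse_eq_divide of_nat_0_less_iff zero_less_Suc)
  have "norm ((\<Sum>l<n. G ((real l + \<theta>) / real n)) / real n - integral {0..1} G) < e" if n: "n \<ge> N" for n
  proof -
    have n0: "n > 0" using N n by simp
    have nd: "1 / real n < d"
    proof -
      have "1 / real n \<le> 1 / real N" using N n by (simp add: frac_le)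
      then show ?thesis using N by simp
    qed
    have "\<bar>integral {0..real k / real n} G - (\<Sum>l<k. G ((real l + \<theta>) / real n)) / real n\<bar>
        \<le> real k * (e / 2 / real n)" if "k \<le> n" for k
      using that
    proof (induction k)
      case (Suc k)
      let ?a = "real k / real n" and ?b = "real (Suc k) / real n"
      define p where "p = (real k + \<theta>) / real n"
      have ab: "?a \<le> ?b" "0 \<le> ?a" "?b \<le> 1" using Suc.prems n0 by (auto simp: field_simps)
      have p: "?a \<le> p" "p \<le> ?b" unfolding p_def using \<theta> n0 by (auto intro!: divide_right_mono)
      have cont: "continuous_on {?a..?b} G" by (rule continuous_on_subset[OF G]) (use ab in auto)
      have len: "?b - ?a = 1 / real n" using n0 by (simp add: field_simps)
      have X: "norm (integral {?a..?b} (\<lambda>t. G t - G p)) \<le> e / 2 * (?b - ?a)"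
      proof (rule integral_bound[OF ab(1)])
        show "continuous_on {?a..?b} (\<lambda>t. G t - G p)" by (intro continuous_intros cont)
        fix t assume t: "t \<in> {?a..?b}"
        then have "dist t p < d" using p len nd by (auto simp: dist_real_def)
        moreover have "t \<in> {0..1}" "p \<in> {0..1}"
          using t p ab unfolding atLeastAtMost_iff by linarith+
        ultimately have "dist (G t) (G p) < e / 2" by (intro d(2))
        then show "norm (G t - G p) \<le> e / 2" by (simp add: dist_real_def)
      qed
      have split_p: "integral {?a..?b} (\<lambda>t. G t - G p) = integral {?a..?b} G - G p / real n"
        using ab len integrable_continuous_real[OF cont]
        by (subst Henstock_Kurzweil_Integration.integral_diff) auto
      have comb: "integral {0..?a} G + integral {?a..?b} G = integral {0..?b} G"
        using ab continuous_on_subset[OF G, of "{0..?b}"]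
        by (intro Henstock_Kurzweil_Integration.integral_combine integrable_continuous_real) auto
      have sums: "(\<Sum>l<Suc k. G ((real l + \<theta>) / real n)) / real n =
          (\<Sum>l<k. G ((real l + \<theta>) / real n)) / real n + G p / real n"
        by (simp add: p_def add_divide_distrib)
      have "\<bar>integral {0..?b} G - (\<Sum>l<Suc k. G ((real l + \<theta>) / real n)) / real n\<bar> \<le>
          \<bar>integral {0..?a} G - (\<Sum>l<k. G ((real l + \<theta>) / real n)) / real n\<bar> +
          \<bar>integral {?a..?b} (\<lambda>t. G t - G p)\<bar>"
        unfolding sums split_p comb[symmetric] by linarith
      also have "\<dots> \<le> real k * (e / 2 / real n) + e / 2 * (?b - ?a)"
        using Suc.IH Suc.prems X unfolding real_norm_def by (intro add_mono) auto
      also have "\<dots> = real (Suc k) * (e / 2 / real n)"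
        unfolding len by (simp add: distrib_right add_divide_distrib)
      finally show ?case .
    qed simp
    from this[of n] have "\<bar>integral {0..1} G - (\<Sum>l<n. G ((real l + \<theta>) / real n)) / real n\<bar> \<le> e / 2"
      using n0 by simp
    then show ?thesis using e by (simp add: abs_minus_commute)
  qed
  then show "\<exists>N. \<forall>n\<ge>N. norm ((\<Sum>l<n. G ((real l + \<theta>) / real n)) / real n - integral {0..1} G) < e"
    by blast
qed

section \<open>The Laurent polynomial on the unit circle\<close>

text \<open>
  The values of \<open>L\<close> on the unit circle, where \<open>2 - u - u\<^bsup>-1\<^esup> = \<bar>1 - u\<bar>\<^sup>2\<close>. In this form they are
  visibly real and nonnegative, and a zero forces \<open>z\<^bsup>s\<^sub>i\<^esup> = 1\<close> for all \<open>i\<close>.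
\<close>
definition L_circle :: "(nat \<Rightarrow> nat) \<Rightarrow> nat \<Rightarrow> complex \<Rightarrow> real" where
  "L_circle s k z = (\<Sum>i=1..k. (norm (1 - z ^ s i))\<^sup>2)"

lemma L_poly_on_circle:
  assumes "norm z = 1"
  shows "L_poly s k z = of_real (L_circle s k z)"
proof -
  have term_eq: "of_real ((norm (1 - u))\<^sup>2) = 2 - (u + inverse u)" if "norm u = 1" for u :: complex
  proof -
    have uu: "u * cnj u = 1" using that by (simp flip: complex_norm_square)
    then have inv: "inverse u = cnj u" by (metis inverse_unique)
    have "of_real ((norm (1 - u))\<^sup>2) = (1 - u) * (1 - cnj u)"
      using complex_norm_square[of "1 - u"] by simp
    also have "\<dots> = 2 - (u + inverse u)" unfolding inv using uu by (simp add: algebra_simps)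
    finally show ?thesis .
  qed
  have "L_poly s k z = (\<Sum>i=1..k. 2 - (z ^ s i + inverse (z ^ s i)))"
    by (simp add: L_poly_def power_int_minus sum_subtractf)
  also have "\<dots> = (\<Sum>i=1..k. of_real ((norm (1 - z ^ s i))\<^sup>2))"
    using assms by (intro sum.cong refl term_eq[symmetric]) (simp add: norm_power)
  finally show ?thesis by (simp add: L_circle_def)
qed

text \<open>
  What remains of \<open>L\<close> at \<open>z\<close>, as a function of \<open>w = z\<^sup>g\<close>, when \<open>\<bar>1 - w\<bar>\<^sup>2\<close> is divided out of each
  \<open>\<bar>1 - w\<^bsup>s\<^sub>i/g\<^esup>\<bar>\<^sup>2\<close> by the geometric sum.
\<close>
definition L_cofactor :: "(nat \<Rightarrow> nat) \<Rightarrow> nat \<Rightarrow> nat \<Rightarrow> complex \<Rightarrow> real" where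
  "L_cofactor s k g w = (\<Sum>i=1..k. (norm (\<Sum>j<s i div g. w ^ j))\<^sup>2)"

lemma L_circle_factor:
  assumes "\<forall>i\<in>{1..k}. g dvd s i"
  shows "L_circle s k z = (norm (1 - z ^ g))\<^sup>2 * L_cofactor s k g (z ^ g)"
proof -
  have "(norm (1 - z ^ s i))\<^sup>2 = (norm (1 - z ^ g))\<^sup>2 * (norm (\<Sum>j<s i div g. (z ^ g) ^ j))\<^sup>2"
    if i: "i \<in> {1..k}" for i
  proof -
    have "z ^ s i = (z ^ g) ^ (s i div g)" using assms i by (simp flip: power_mult)
    then show ?thesis by (simp add: one_diff_power_eq norm_mult power_mult_distrib)
  qed
  then show ?thesis by (simp add: L_circle_def L_cofactor_def sum_distrib_left)
qed

lemma power_Gcd_eq_one: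
  fixes z :: complex
  assumes "finite A" "norm z = 1" "\<And>a. a \<in> A \<Longrightarrow> z ^ a = 1"
  shows "z ^ Gcd A = 1"
proof -
  have z: "z \<noteq> 0" using assms(2) by auto
  have "z powi int (Gcd A) = 1"
    by (rule Gcd_closed_under_group[OF assms(1)])
       (use assms(3) z in \<open>auto simp: power_int_add power_int_minus\<close>)
  then show ?thesis by simp
qed

text \<open>
  A zero of the cofactor is a zero of \<open>L\<close>, so \<open>z\<^bsup>s\<^sub>i\<^esup> = 1\<close> for all \<open>i\<close> and hence \<open>z\<^sup>g = 1\<close>. But
  at \<open>w = 1\<close> the cofactor is \<open>\<Sum>\<^sub>i (s\<^sub>i/g)\<^sup>2\<close>, which is positive.
\<close>
lemma L_cofactor_pos:
  assumes k: "k \<ge> 1" and s: "s 1 \<ge> 1" and g: "g = Gcd (s ` {1..k})" and z: "norm z = 1"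
  shows "L_cofactor s k g (z ^ g) > 0"
proof -
  have gs: "\<forall>i\<in>{1..k}. g dvd s i" unfolding g by (intro ballI Gcd_dvd) simp
  have "L_cofactor s k g (z ^ g) \<noteq> 0"
  proof
    assume 0: "L_cofactor s k g (z ^ g) = 0"
    then have "L_circle s k z = 0" by (simp add: L_circle_factor[OF gs])
    then have "\<forall>i\<in>{1..k}. (norm (1 - z ^ s i))\<^sup>2 = 0"
      unfolding L_circle_def by (subst (asm) sum_nonneg_eq_0_iff) auto
    then have "z ^ g = 1" unfolding g using z by (intro power_Gcd_eq_one) auto
    then have "(\<Sum>i=1..k. (real (s i div g))\<^sup>2) = 0" using 0 by (simp add: L_cofactor_def)
    then have "\<forall>i\<in>{1..k}. (real (s i div g))\<^sup>2 = 0"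
      by (subst (asm) sum_nonneg_eq_0_iff) auto
    then have "s 1 div g = 0" using k by simp
    moreover have "g dvd s 1" using gs k by simp
    ultimately show False using s by (simp add: dvd_div_eq_0_iff)
  qed
  moreover have "L_cofactor s k g (z ^ g) \<ge> 0" by (auto simp: L_cofactor_def intro!: sum_nonneg)
  ultimately show ?thesis by simp
qed

section \<open>Spanning trees of even circulant graphs\<close>

lemma prod_split_parity:
  fixes a :: "nat \<Rightarrow> 'a::comm_monoid_mult"
  assumes "n > 0"
  shows "(\<Prod>l=1..<2 * n. a l) = (\<Prod>j=1..<n. a (2 * j)) * (\<Prod>j<n. a (2 * j + 1))"
proof -
  have "(\<Prod>l=1..<2 * Suc n. a l) = (\<Prod>j=1..<Suc n. a (2 * j)) * (\<Prod>j<Suc n. a (2 * j + 1))" for n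
  proof (induction n)
    case (Suc n)
    have "(\<Prod>l=1..<2 * Suc (Suc n). a l) = (\<Prod>l=1..<2 * Suc n. a l) * a (2 * Suc n) * a (2 * Suc n + 1)"
      by (simp add: prod.atLeastLessThan_Suc)
    also have "\<dots> = ((\<Prod>j=1..<Suc n. a (2 * j)) * a (2 * Suc n)) *
        ((\<Prod>j<Suc n. a (2 * j + 1)) * a (2 * Suc n + 1))"
      unfolding Suc by (simp only: mult_ac)
    also have "(\<Prod>j=1..<Suc n. a (2 * j)) * a (2 * Suc n) = (\<Prod>j=1..<Suc (Suc n). a (2 * j))"
      by (simp add: prod.atLeastLessThan_Suc)
    also have "(\<Prod>j<Suc n. a (2 * j + 1)) * a (2 * Suc n + 1) = (\<Prod>j<Suc (Suc n). a (2 * j + 1))"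
      by (rule prod.lessThan_Suc[symmetric])
    finally show ?case .
  qed (simp add: numeral_2_eq_2)
  from this[of "n - 1"] show ?thesis using assms by simp
qed

lemma sum_even_circulant_jumps:
  fixes f :: "nat \<Rightarrow> complex" and s :: "nat \<Rightarrow> nat"
  assumes inj: "inj_on s {1..k}" and s: "\<And>i. i \<in> {1..k} \<Longrightarrow> 1 \<le> s i \<and> s i < n"
  defines "D \<equiv> insert n (s ` {1..k})"
  shows "(\<Sum>d\<in>D \<union> (\<lambda>d. 2 * n - d) ` D. f d) = (\<Sum>i=1..k. f (s i) + f (2 * n - s i)) + f n"
proof -
  let ?S = "s ` {1..k}" and ?T = "(\<lambda>i. 2 * n - s i) ` {1..k}"
  have jumps: "D \<union> (\<lambda>d. 2 * n - d) ` D = insert n (?S \<union> ?T)"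
    unfolding D_def by (auto simp: image_image)
  have inter: "n \<notin> ?S \<union> ?T" "?S \<inter> ?T = {}"
  proof -
    have below: "d < n" if "d \<in> ?S" for d using that s by auto
    have above: "n < d" if "d \<in> ?T" for d
  proof -
    obtain i where "i \<in> {1..k}" "d = 2 * n - s i" using \<open>d \<in> ?T\<close> by auto
    then show ?thesis using s[of i] by linarith
  qed
    show "n \<notin> ?S \<union> ?T" "?S \<inter> ?T = {}" using below above by fastforce+
  qed
  have injT: "inj_on (\<lambda>i. 2 * n - s i) {1..k}"
  proof (rule inj_onI)
    fix i j assume ij: "i \<in> {1..k}" "j \<in> {1..k}" "2 * n - s i = 2 * n - s j"
    then have "s i = s j" using s[OF ij(1)] s[OF ij(2)] by linarith
    then show "i = j" using inj ij by (auto dest: inj_onD)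
  qed
  have "sum f (insert n (?S \<union> ?T)) = f n + (sum f ?S + sum f ?T)"
    using inter(1) sum.union_disjoint[OF _ _ inter(2), of f] by simp
  then show ?thesis unfolding jumps sum.reindex[OF inj] sum.reindex[OF injT] by (simp add: sum.distrib)
qed

text \<open>
  The eigenvalue at \<open>w = exp (2\<pi>\<i>l/2n)\<close> is \<open>L(w) + 1 - w\<^sup>n = L(w) + 1 - (-1)\<^sup>l\<close>. Even \<open>l = 2j\<close> give
  the points \<open>j/n\<close> of the circle, odd \<open>l = 2j + 1\<close> the points \<open>(j + 1/2)/n\<close>.
\<close>
theorem spanning_trees_even_circulant:
  assumes inj: "inj_on s {1..k}" and s: "\<And>i. i \<in> {1..k} \<Longrightarrow> 1 \<le> s i \<and> s i < n" and n: "n > 0"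
  shows "real (2 * n * num_spanning_trees {..<2 * n} (even_circulant_edges s k n)) =
    (\<Prod>j=1..<n. L_circle s k (cis (2 * pi * (real j / real n)))) *
    (\<Prod>j<n. L_circle s k (cis (2 * pi * ((real j + 1 / 2) / real n))) + 2)"
proof -
  let ?D = "insert n (s ` {1..k})"
  define ev :: "nat \<Rightarrow> real" where
    "ev l = L_circle s k (unit_root (2 * n) l) + (if even l then 0 else 2)" for l
  have D: "?D \<subseteq> {1..<2 * n}" using s n by force
  have eig: "(\<Sum>d\<in>?D \<union> (\<lambda>d. 2 * n - d) ` ?D. 1 - unit_root (2 * n) l ^ d) = of_real (ev l)" for l
  proof -
    let ?w = "unit_root (2 * n) l"
    have w1: "norm ?w = 1" by (simp add: unit_root_def)
    have wm: "?w ^ (2 * n) = 1" using n by (intro unit_root_power_order) simp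
    have wn: "?w ^ n = (- 1) ^ l"
    proof -
      have "?w ^ n = cis (real n * (2 * pi * real l / real (2 * n)))"
        unfolding unit_root_def by (rule Complex.DeMoivre)
      also have "real n * (2 * pi * real l / real (2 * n)) = real l * pi" using n by simp
      also have "cis (real l * pi) = cis pi ^ l" by (rule Complex.DeMoivre[symmetric])
      finally show ?thesis by simp
    qed
    have w_neg: "?w ^ (2 * n - s i) = inverse (?w ^ s i)" if "i \<in> {1..k}" for i
    proof -
      have "?w ^ (2 * n - s i) * ?w ^ s i = 1"
        using s[OF that] wm by (simp flip: power_add)
      then show ?thesis by (metis inverse_unique mult.commute)
    qed
    have "(\<Sum>d\<in>?D \<union> (\<lambda>d. 2 * n - d) ` ?D. 1 - ?w ^ d) =
        (\<Sum>i=1..k. (1 - ?w ^ s i) + (1 - ?w ^ (2 * n - s i))) + (1 - ?w ^ n)"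
      by (rule sum_even_circulant_jumps[OF inj s])
    also have "(\<Sum>i=1..k. (1 - ?w ^ s i) + (1 - ?w ^ (2 * n - s i))) =
        (\<Sum>i=1..k. 2 - (?w ^ s i + inverse (?w ^ s i)))"
      using w_neg by (intro sum.cong) auto
    also have "\<dots> = L_poly s k ?w"
      by (simp add: L_poly_def power_int_minus sum_subtractf)
    also have "\<dots> + (1 - ?w ^ n) = of_real (ev l)"
      by (simp add: ev_def wn L_poly_on_circle[OF w1])
    finally show ?thesis .
  qed
  have "of_nat (2 * n * num_spanning_trees {..<2 * n} (even_circulant_edges s k n)) =
      (\<Prod>l=1..<2 * n. complex_of_real (ev l))"
    unfolding even_circulant_edges_def
    using n by (intro spanning_trees_circulant[OF _ D, unfolded eig]) simp
  then have "complex_of_real (real (2 * n * num_spanning_trees {..<2 * n} (even_circulant_edges s k n))) =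
      complex_of_real (\<Prod>l=1..<2 * n. ev l)" by simp
  then have "real (2 * n * num_spanning_trees {..<2 * n} (even_circulant_edges s k n)) = (\<Prod>l=1..<2 * n. ev l)"
    unfolding of_real_eq_iff .
  also have "\<dots> = (\<Prod>j=1..<n. ev (2 * j)) * (\<Prod>j<n. ev (2 * j + 1))"
    by (rule prod_split_parity[OF n])
  also have "(\<Prod>j=1..<n. ev (2 * j)) = (\<Prod>j=1..<n. L_circle s k (cis (2 * pi * (real j / real n))))"
    by (simp add: ev_def unit_root_def mult.assoc)
  also have "(\<Prod>j<n. ev (2 * j + 1)) = (\<Prod>j<n. L_circle s k (cis (2 * pi * ((real j + 1 / 2) / real n))) + 2)"
  proof (intro prod.cong refl)
    fix j
    have arg: "2 * pi * real (2 * j + 1) / real (2 * n) = 2 * pi * ((real j + 1 / 2) / real n)"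
      using n by (simp add: field_simps)
    show "ev (2 * j + 1) = L_circle s k (cis (2 * pi * ((real j + 1 / 2) / real n))) + 2"
      unfolding ev_def unit_root_def arg by simp
  qed
  finally show ?thesis .
qed

text \<open>
  Here \<open>2 ln n\<close> is the total contribution of the singular factor \<open>\<bar>1 - z\<^sup>g\<bar>\<^sup>2\<close>, and \<open>H 0\<close> is subtracted
  because the eigenvalue \<open>0\<close> at \<open>j = 0\<close> does not occur in the product.
\<close>
lemma ln_spanning_trees_even_circulant:
  assumes inj: "inj_on s {1..k}" and s: "\<And>i. i \<in> {1..k} \<Longrightarrow> 1 \<le> s i \<and> s i < n"
    and n: "n > 0" and k: "k \<ge> 1"
    and g: "g = Gcd (s ` {1..k})" and co: "coprime g n"
  defines "H \<equiv> \<lambda>t. ln (L_cofactor s k g (cis (2 * pi * t) ^ g))"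
    and "K \<equiv> \<lambda>t. ln (L_circle s k (cis (2 * pi * t)) + 2)"
  shows "ln (real (num_spanning_trees {..<2 * n} (even_circulant_edges s k n))) =
    2 * ln (real n) - ln (2 * real n) - H 0 +
    (\<Sum>j<n. H (real j / real n)) + (\<Sum>j<n. K ((real j + 1 / 2) / real n))"
proof -
  let ?\<tau> = "num_spanning_trees {..<2 * n} (even_circulant_edges s k n)"
  let ?z = "\<lambda>t. cis (2 * pi * t)"
  have gs: "\<forall>i\<in>{1..k}. g dvd s i" unfolding g by (intro ballI Gcd_dvd) simp
  have hpos: "L_cofactor s k g (?z t ^ g) > 0" for t
    using s[of 1] k by (intro L_cofactor_pos g) auto
  have Kpos: "L_circle s k w + 2 > 0" for w
    by (auto simp: L_circle_def intro!: add_nonneg_pos sum_nonneg)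
  define P where "P = (\<Prod>j=1..<n. norm (1 - ?z (real j / real n) ^ g))"
  have P: "P = real n"
  proof -
    have "P = norm (\<Prod>j=1..<n. 1 - cis (2 * pi * (real g * (real j / real n))))"
      unfolding P_def prod_norm[symmetric] Complex.DeMoivre by (simp add: mult_ac)
    then show ?thesis by (simp only: prod_one_minus_dilated_roots[OF n co] norm_of_nat)
  qed
  define Q where "Q = (\<Prod>j=1..<n. L_cofactor s k g (?z (real j / real n) ^ g))"
  define W where "W = (\<Prod>j<n. L_circle s k (?z ((real j + 1 / 2) / real n)) + 2)"
  have Qpos: "Q > 0" unfolding Q_def by (intro prod_pos ballI hpos)
  have Wpos: "W > 0" unfolding W_def by (intro prod_pos ballI Kpos)
  have "real (2 * n * ?\<tau>) = P\<^sup>2 * Q * W"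
  proof -
    have "(\<Prod>j=1..<n. L_circle s k (?z (real j / real n))) = P\<^sup>2 * Q"
      unfolding L_circle_factor[OF gs] prod.distrib P_def Q_def prod_power_distrib ..
    then show ?thesis using spanning_trees_even_circulant[OF inj s n] by (simp only: W_def)
  qed
  then have eq: "2 * real n * real ?\<tau> = (real n)\<^sup>2 * Q * W" by (simp add: P)
  have "(real n)\<^sup>2 * Q * W > 0" using n Qpos Wpos by simp
  then have \<tau>pos: "real ?\<tau> > 0" unfolding eq[symmetric] using n by (simp add: zero_less_mult_iff)
  have "ln (2 * real n * real ?\<tau>) = ln (2 * real n) + ln (real ?\<tau>)"
    using n \<tau>pos by (simp add: ln_mult)
  moreover have "ln ((real n)\<^sup>2 * Q * W) = 2 * ln (real n) + ln Q + ln W"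
    using n Qpos Wpos by (simp add: ln_mult ln_realpow)
  moreover have "ln Q = (\<Sum>j=1..<n. H (real j / real n))"
    unfolding Q_def H_def by (intro ln_prod finite_atLeastLessThan less_imp_neq[OF hpos, symmetric])
  moreover have "{..<n} = insert 0 {1..<n}" using n by auto
  then have "(\<Sum>j<n. H (real j / real n)) = H 0 + (\<Sum>j=1..<n. H (real j / real n))" by simp
  moreover have "ln W = (\<Sum>j<n. K ((real j + 1 / 2) / real n))"
    unfolding W_def K_def by (intro ln_prod finite_lessThan less_imp_neq[OF Kpos, symmetric])
  ultimately show ?thesis unfolding eq by linarith
qed

section \<open>The small Mahler measure\<close>

lemma continuous_on_L_circle [continuous_intros]:
  "continuous_on S f \<Longrightarrow> continuous_on S (\<lambda>t. L_circle s k (f t))"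
  unfolding L_circle_def by (intro continuous_intros)

lemma continuous_on_L_cofactor [continuous_intros]:
  "continuous_on S f \<Longrightarrow> continuous_on S (\<lambda>t. L_cofactor s k g (f t))"
  unfolding L_cofactor_def by (intro continuous_intros)

lemma L_circle_nonneg: "0 \<le> L_circle s k z"
  unfolding L_circle_def by (intro sum_nonneg) simp

lemma small_mahler_integrand_eq:
  "small_mahler_integrand (R_poly s k) t =
     ln (L_circle s k (cis (2 * pi * t)) * (L_circle s k (cis (2 * pi * t)) + 2))"
proof -
  let ?z = "cis (2 * pi * t)"
  have "exp (2 * of_real pi * \<i> * of_real t) = ?z"
    by (simp add: cis_conv_exp mult_ac)
  moreover have "R_poly s k ?z = of_real (L_circle s k ?z * (L_circle s k ?z + 2))"
    by (simp add: R_poly_def L_poly_on_circle)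
  ultimately show ?thesis
    unfolding small_mahler_integrand_def
    using L_circle_nonneg[of s k ?z] by (simp only: norm_of_real abs_of_nonneg mult_nonneg_nonneg add_nonneg_nonneg zero_le_numeral)
qed

lemma finite_cis_dilated_eq_one:
  assumes "g > 0"
  shows "finite {t \<in> {0..1}. cis (2 * pi * t) ^ g = 1}"
proof (rule finite_subset)
  show "{t \<in> {0..1}. cis (2 * pi * t) ^ g = 1} \<subseteq> (\<lambda>j. real_of_int j / real g) ` {0..int g}"
  proof
    fix t assume t: "t \<in> {t \<in> {0..1}. cis (2 * pi * t) ^ g = 1}"
    then have "cis (real g * (2 * pi * t)) = 1" by (simp add: Complex.DeMoivre)
    then have "cos (real g * (2 * pi * t)) = 1" by (simp add: complex_eq_iff)
    then obtain j :: int where "real g * (2 * pi * t) = real_of_int j * 2 * pi"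
      unfolding cos_one_2pi_int by blast
    then have j: "real g * t = j" by simp
    have "0 \<le> real g * t" using t by simp
    moreover have "real g * t \<le> real g * 1" using t by (intro mult_left_mono) auto
    ultimately have "j \<in> {0..int g}" unfolding j by auto
    moreover have "t = j / real g" using j assms by (simp add: field_simps)
    ultimately show "t \<in> (\<lambda>j. real_of_int j / real g) ` {0..int g}" by blast
  qed
qed simp

context
  fixes s :: "nat \<Rightarrow> nat" and k g :: nat
  assumes k: "k \<ge> 1" and s1: "s 1 \<ge> 1" and g: "g = Gcd (s ` {1..k})"
begin

lemma continuous_on_ln_L_cofactor:
  "continuous_on S (\<lambda>t. ln (L_cofactor s k g (cis (2 * pi * t) ^ g)))"
  using L_cofactor_pos[OF k s1 g] by (intro continuous_intros) (auto simp: less_imp_neq[symmetric])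

lemma continuous_on_ln_L_circle_plus_2:
  "continuous_on S (\<lambda>t. ln (L_circle s k (cis (2 * pi * t)) + 2))"
  using L_circle_nonneg[of s k] by (intro continuous_intros) (smt (verit))

lemma small_mahler_integrand_decomp:
  assumes "cis (2 * pi * t) ^ g \<noteq> 1"
  shows "small_mahler_integrand (R_poly s k) t = 2 * circle_log (real g * t) +
    ln (L_cofactor s k g (cis (2 * pi * t) ^ g)) + ln (L_circle s k (cis (2 * pi * t)) + 2)"
proof -
  let ?z = "cis (2 * pi * t)"
  have gs: "\<forall>i\<in>{1..k}. g dvd s i" unfolding g by (intro ballI Gcd_dvd) simp
  have "circle_log (real g * t) = ln (norm (1 - ?z ^ g))"
    unfolding circle_log_def Complex.DeMoivre by (simp add: mult_ac)
  moreover have "norm (1 - ?z ^ g) > 0" using assms by simp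
  moreover have "L_cofactor s k g (?z ^ g) > 0" using L_cofactor_pos[OF k s1 g] by simp
  moreover have "L_circle s k ?z + 2 > 0" using L_circle_nonneg[of s k ?z] by simp
  moreover have "small_mahler_integrand (R_poly s k) t =
      ln ((norm (1 - ?z ^ g))\<^sup>2 * L_cofactor s k g (?z ^ g) * (L_circle s k ?z + 2))"
    unfolding small_mahler_integrand_eq by (subst L_circle_factor[OF gs]) (rule refl)
  ultimately show ?thesis by (simp add: ln_mult ln_realpow)
qed

lemma g_pos: "g > 0"
proof -
  have "g dvd s 1" unfolding g using k by (intro Gcd_dvd) simp
  then show ?thesis using s1 by (cases "g = 0") auto
qed

lemma small_mahler_integrand_has_integral:
  "(small_mahler_integrand (R_poly s k) has_integral
     integral {0..1} (\<lambda>t. ln (L_cofactor s k g (cis (2 * pi * t) ^ g))) +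
     integral {0..1} (\<lambda>t. ln (L_circle s k (cis (2 * pi * t)) + 2))) {0..1}"
proof -
  have "((\<lambda>t. 2 * circle_log (real g * t) + ln (L_cofactor s k g (cis (2 * pi * t) ^ g)) +
      ln (L_circle s k (cis (2 * pi * t)) + 2)) has_integral
      (2 * 0 + integral {0..1} (\<lambda>t. ln (L_cofactor s k g (cis (2 * pi * t) ^ g)))) +
      integral {0..1} (\<lambda>t. ln (L_circle s k (cis (2 * pi * t)) + 2))) {0..1}"
    by (intro has_integral_add has_integral_mult_right circle_log_dilated_has_integral g_pos
        integrable_integral integrable_continuous_real continuous_on_ln_L_cofactor
        continuous_on_ln_L_circle_plus_2)
  then have "((\<lambda>t. 2 * circle_log (real g * t) + ln (L_cofactor s k g (cis (2 * pi * t) ^ g)) +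
      ln (L_circle s k (cis (2 * pi * t)) + 2)) has_integral
      integral {0..1} (\<lambda>t. ln (L_cofactor s k g (cis (2 * pi * t) ^ g))) +
      integral {0..1} (\<lambda>t. ln (L_circle s k (cis (2 * pi * t)) + 2))) {0..1}" by simp
  then show ?thesis
    by (rule has_integral_spike_finite[OF finite_cis_dilated_eq_one[OF g_pos], rotated])
       (rule small_mahler_integrand_decomp, simp)
qed

text \<open>
  An integrable function that is bounded above is absolutely integrable, and \<open>ln \<bar>R\<bar>\<close> is bounded above
  because \<open>R\<close> is continuous on the circle.
\<close>
lemma small_mahler_integrand_set_integrable:
  "set_integrable lborel {0..1} (small_mahler_integrand (R_poly s k))"
proof -
  let ?f = "small_mahler_integrand (R_poly s k)"
  define F where "F t = L_circle s k (cis (2 * pi * t)) * (L_circle s k (cis (2 * pi * t)) + 2)" for t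
  have contF: "continuous_on S F" for S unfolding F_def by (intro continuous_intros)
  have f: "?f = (\<lambda>t. ln (F t))"
    by (rule ext) (simp add: F_def small_mahler_integrand_eq)
  have "F \<in> borel_measurable borel" by (intro borel_measurable_continuous_onI contF)
  then have meas: "?f \<in> borel_measurable borel" unfolding f by (rule borel_measurable_ln)
  obtain B where B: "\<And>t. t \<in> {0..1} \<Longrightarrow> F t \<le> B"
  proof -
    have "bounded (F ` {0..1})" by (intro compact_imp_bounded compact_continuous_image contF) simp
    then obtain B where "\<forall>x\<in>F ` {0..1}. norm x \<le> B" by (auto simp: bounded_iff)
    then show ?thesis using that[of B] by (auto simp: abs_le_iff)
  qed
  have "?f absolutely_integrable_on {0..1}"
  proof (rule absolutely_integrable_absolutely_integrable_ubound)
    show "?f integrable_on {0..1}" using small_mahler_integrand_has_integral by blast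
    show "(\<lambda>t. max B 1 - 1) absolutely_integrable_on {0..1::real}"
      by (intro absolutely_integrable_continuous_real continuous_intros)
    \<comment> \<open>\<open>ln x \<le> x - 1\<close>, and the maximum with \<open>1\<close> covers the zeros of \<open>R\<close>, where the integrand is \<open>0\<close>\<close>
    show "?f t \<le> max B 1 - 1" if "t \<in> {0..1}" for t
    proof (cases "F t > 0")
      case True
      then show ?thesis using ln_le_minus_one[OF True] B[OF that] unfolding f by linarith
    next
      case False
      then have "F t = 0" using L_circle_nonneg[of s k "cis (2 * pi * t)"] by (simp add: F_def not_less mult_le_0_iff)
      then show ?thesis by (simp add: f)
    qed
  qed
  moreover have "(\<lambda>t. indicator {0..1} t *\<^sub>R ?f t) \<in> borel_measurable lborel"
    using meas by simp
  ultimately show ?thesis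
    unfolding set_integrable_def by (subst (asm) integrable_completion) auto
qed

lemma small_mahler_R_poly:
  "small_mahler (R_poly s k) = integral {0..1} (\<lambda>t. ln (L_cofactor s k g (cis (2 * pi * t) ^ g))) +
     integral {0..1} (\<lambda>t. ln (L_circle s k (cis (2 * pi * t)) + 2))"
  unfolding small_mahler_def
  using set_borel_integral_eq_integral(2)[OF small_mahler_integrand_set_integrable]
    integral_unique[OF small_mahler_integrand_has_integral] by simp

end

section \<open>The growth rate\<close>

lemma Gcd_double_insert: "Gcd (insert (2 * n) (insert n A)) = Gcd (insert n (A :: nat set))"
proof -
  have "gcd (2 * n) n = n" by simp
  then show ?thesis by (simp flip: gcd.assoc)
qed

theorem corollary4:
  fixes s :: "nat \<Rightarrow> nat" and k :: nat
  assumes "k \<ge> 1"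
    and "s 1 \<ge> 1"
    and "strict_mono_on {1..k} s"
  shows "(\<forall>n. n > s k \<longrightarrow>
            (graph_connected {..<2 * n} (even_circulant_edges s k n) \<longleftrightarrow>
             Gcd (insert n (s ` {1..k})) = 1)) \<and>
         set_integrable lborel {0..1} (small_mahler_integrand (R_poly s k)) \<and>
         ((\<lambda>n. ln (real (num_spanning_trees {..<2 * n} (even_circulant_edges s k n))) / real n)
            \<longlongrightarrow> small_mahler (R_poly s k))
           (inf at_top (principal
              {n. n > s k \<and> graph_connected {..<2 * n} (even_circulant_edges s k n)}))"
proof (intro conjI)
  define g where "g = Gcd (s ` {1..k})"
  have inj: "inj_on s {1..k}" using assms(3) by (rule strict_mono_on_imp_inj_on)
  have s_bounds: "1 \<le> s i \<and> s i \<le> s k" if "i \<in> {1..k}" for i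
  proof -
    have "s 1 \<le> s i" "s i \<le> s k"
      using that assms(1) strict_mono_on_leD[OF assms(3)] by auto
    then show ?thesis using assms(2) by simp
  qed
  have connected_iff: "graph_connected {..<2 * n} (even_circulant_edges s k n) \<longleftrightarrow>
      Gcd (insert n (s ` {1..k})) = 1" if n: "n > s k" for n
  proof -
    have "insert n (s ` {1..k}) \<subseteq> {1..<2 * n}"
      using s_bounds n by fastforce
    then have "graph_connected {..<2 * n} (even_circulant_edges s k n) \<longleftrightarrow>
        Gcd (insert (2 * n) (insert n (s ` {1..k}))) = 1"
      unfolding even_circulant_edges_def
      using circulant_connected_if_Gcd circulant_connected_imp_Gcd n
      by (metis gr_implies_not0 mult_pos_pos neq0_conv zero_less_numeral)
    then show ?thesis unfolding Gcd_double_insert .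
  qed
  then show "\<forall>n. n > s k \<longrightarrow> (graph_connected {..<2 * n} (even_circulant_edges s k n) \<longleftrightarrow>
      Gcd (insert n (s ` {1..k})) = 1)" by blast
  show "set_integrable lborel {0..1} (small_mahler_integrand (R_poly s k))"
    by (rule small_mahler_integrand_set_integrable[OF assms(1,2) g_def])
  define H where "H = (\<lambda>t. ln (L_cofactor s k g (cis (2 * pi * t) ^ g)))"
  define K where "K = (\<lambda>t. ln (L_circle s k (cis (2 * pi * t)) + 2))"
  have "(\<lambda>n. (\<Sum>l<n. H ((real l + 0) / real n)) / real n) \<longlonglongrightarrow> integral {0..1} H"
    unfolding H_def using continuous_on_ln_L_cofactor[OF assms(1,2) g_def] by (intro riemann_sum_tendsto) auto
  moreover have "(\<lambda>n. (\<Sum>l<n. K ((real l + 1 / 2) / real n)) / real n) \<longlonglongrightarrow> integral {0..1} K"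
    unfolding K_def using continuous_on_ln_L_circle_plus_2[OF assms(1,2) g_def] by (intro riemann_sum_tendsto) auto
  moreover have "(\<lambda>n. (2 * ln (real n) - ln (2 * real n) - H 0) / real n) \<longlonglongrightarrow> 0"
    by real_asymp
  ultimately have lim: "(\<lambda>n. (2 * ln (real n) - ln (2 * real n) - H 0) / real n +
      (\<Sum>l<n. H ((real l + 0) / real n)) / real n + (\<Sum>l<n. K ((real l + 1 / 2) / real n)) / real n)
      \<longlonglongrightarrow> 0 + integral {0..1} H + integral {0..1} K"
    by (intro tendsto_add)
  have mahler: "small_mahler (R_poly s k) = 0 + integral {0..1} H + integral {0..1} K"
    unfolding small_mahler_R_poly[OF assms(1,2) g_def] by (simp add: H_def K_def)
  let ?F = "inf at_top (principal {n. n > s k \<and> graph_connected {..<2 * n} (even_circulant_edges s k n)})"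
  \<comment> \<open>on the filter the formula for \<open>ln \<tau>\<close> holds exactly, since connectedness makes \<open>g\<close> and \<open>n\<close> coprime\<close>
  have "\<forall>\<^sub>F n in ?F. (2 * ln (real n) - ln (2 * real n) - H 0) / real n +
      (\<Sum>l<n. H ((real l + 0) / real n)) / real n + (\<Sum>l<n. K ((real l + 1 / 2) / real n)) / real n =
      ln (real (num_spanning_trees {..<2 * n} (even_circulant_edges s k n))) / real n"
    unfolding eventually_inf_principal
  proof (intro always_eventually allI impI)
    fix n assume "n \<in> {n. n > s k \<and> graph_connected {..<2 * n} (even_circulant_edges s k n)}"
    then have n: "n > s k" "Gcd (insert n (s ` {1..k})) = 1" using connected_iff by auto
    have "coprime g n" using n(2) by (simp add: g_def coprime_iff_gcd_eq_1 gcd.commute)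
    then have "ln (real (num_spanning_trees {..<2 * n} (even_circulant_edges s k n))) =
        2 * ln (real n) - ln (2 * real n) - H 0 +
        (\<Sum>j<n. H (real j / real n)) + (\<Sum>j<n. K ((real j + 1 / 2) / real n))"
      unfolding H_def K_def using s_bounds n(1) assms(1)
      by (intro ln_spanning_trees_even_circulant inj g_def) (auto intro: le_less_trans)
    then show "(2 * ln (real n) - ln (2 * real n) - H 0) / real n +
        (\<Sum>l<n. H ((real l + 0) / real n)) / real n + (\<Sum>l<n. K ((real l + 1 / 2) / real n)) / real n =
        ln (real (num_spanning_trees {..<2 * n} (even_circulant_edges s k n))) / real n"
      by (simp add: add_divide_distrib)
  qed
  then show "((\<lambda>n. ln (real (num_spanning_trees {..<2 * n} (even_circulant_edges s k n))) / real n)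
      \<longlongrightarrow> small_mahler (R_poly s k)) ?F"
    unfolding mahler by (rule Lim_transform_eventually[OF tendsto_mono[OF inf_le1 lim]])
qed

end
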